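(* Let $\mathcal K$ be a complex separable Hilbert space with an anti-unitary involution $\Gamma$. Given two selfadjoint operators $R,S\in B(\mathcal K)$ such that $0\le R\le\mathbf 1$ and $R+\Gamma R\Gamma=S+\Gamma S\Gamma=\mathbf 1$, assume that $$S-R\in L^1(\mathcal K).$$ Then the quasi-free functional $\phi_S$ on $\mathrm{CAR}(\mathcal K,\Gamma)$ is bounded and normal in the GNS representation of the quasi-free state $\phi_R$.
   Context: $L^1(\mathcal K)\subset B(\mathcal K)$ is the ideal of trace-class operators. $\mathrm{CAR}(\mathcal K,\Gamma)$ is the selfdual CAR algebra: the unital C*-algebra generated by elements $F(f)$, $f\in\mathcal K$, linear in $f$, with $F(f)^*F(g)+F(g)F(f)^*=\langle f,g\rangle\mathbf 1$ and $F(f)^*=F(\Gamma f)$ (inner product linear in the second variable). For selfadjoint $S\in B(\mathcal K)$ with $S=\mathbf 1-\Gamma S\Gamma$, the quasi-free functional $\phi_S$ is the linear functional, a priori defined on the *-algebra generated by the $F(f)$, $f\in\mathcal K$, normalized by $\phi_S(\mathbf 1)=1$, vanishing on monomials of odd degree and satisfying $\phi_S(F(f)^*F(g))=\langle f,Sg\rangle$ and $\phi_S(F(f_1)\cdots F(f_{2n}))=\sum_{j=2}^{2n}(-1)^j\phi_S(F(f_1)F(f_j))\,\phi_S(\prod_{i\neq1,j}F(f_i))$ (product in increasing order). If moreover $0\le S\le\mathbf 1$ it extends to a state on $\mathrm{CAR}(\mathcal K,\Gamma)$. "Normal in the GNS representation $\pi_{\phi_R}$" means that there is a normal functional $\tilde\phi$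 on the von Neumann algebra $\pi_{\phi_R}(\mathrm{CAR}(\mathcal K,\Gamma))''$ with $\phi_S=\tilde\phi\circ\pi_{\phi_R}$. *)

theory Defs
  imports "HOL-Analysis.Analysis"
begin

section \<open>Complex Hilbert spaces and unital C*-algebras\<close>

class complex_vector = real_vector +
  fixes scaleC :: "complex \<Rightarrow> 'a \<Rightarrow> 'a" (infixr "*\<^sub>C" 75)
  assumes scaleC_add_right: "c *\<^sub>C (x + y) = c *\<^sub>C x + c *\<^sub>C y"
    and scaleC_add_left: "(c + d) *\<^sub>C x = c *\<^sub>C x + d *\<^sub>C x"
    and scaleC_scaleC: "c *\<^sub>C d *\<^sub>C x = (c * d) *\<^sub>C x"
    and scaleC_of_real: "complex_of_real r *\<^sub>C x = r *\<^sub>R x"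

class complex_normed_vector = complex_vector + real_normed_vector +
  assumes norm_scaleC: "norm (c *\<^sub>C x) = cmod c * norm x"

class complex_inner = complex_normed_vector +
  fixes cinner :: "'a \<Rightarrow> 'a \<Rightarrow> complex"
  assumes cinner_commute: "cinner x y = cnj (cinner y x)"
    and cinner_add_right: "cinner x (y + z) = cinner x y + cinner x z"
    and cinner_scaleC_right: "cinner x (c *\<^sub>C y) = c * cinner x y"
    and cinner_self: "cinner x x = complex_of_real ((norm x)\<^sup>2)"

class chilbert_space = complex_inner + complete_space

class unital_cstar_algebra = complex_normed_vector + real_normed_algebra_1 + complete_space +
  fixes star :: "'a \<Rightarrow> 'a"
  assumes mult_scaleC_left: "(c *\<^sub>C x) * y = c *\<^sub>C (x * y)"
    and mult_scaleC_right: "x * (c *\<^sub>C y) = c *\<^sub>C (x * y)"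
    and star_star: "star (star x) = x"
    and star_add: "star (x + y) = star x + star y"
    and star_scaleC: "star (c *\<^sub>C x) = cnj c *\<^sub>C star x"
    and star_mult: "star (x * y) = star y * star x"
    and cstar_identity: "norm (star x * x) = (norm x)\<^sup>2"

instantiation complex :: chilbert_space
begin
definition scaleC_complex :: "complex \<Rightarrow> complex \<Rightarrow> complex" where "scaleC_complex c z = c * z"
definition cinner_complex :: "complex \<Rightarrow> complex \<Rightarrow> complex" where "cinner_complex x y = cnj x * y"
instance
proof
  fix x :: complex
  show "cinner x x = complex_of_real ((norm x)\<^sup>2)"
    by (simp add: cinner_complex_def complex_norm_square mult.commute del: of_real_power)
qed (auto simp: scaleC_complex_def cinner_complex_def algebra_simps norm_mult scaleR_conv_of_real)
end

instantiation complex :: unital_cstar_algebra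
begin
definition star_complex :: "complex \<Rightarrow> complex" where "star_complex z = cnj z"
instance
  by standard (auto simp: scaleC_complex_def star_complex_def norm_mult power2_eq_square)
end

definition clinear_on :: "'a::complex_vector set \<Rightarrow> ('a \<Rightarrow> 'b::complex_vector) \<Rightarrow> bool" where
  "clinear_on V f \<longleftrightarrow> (\<forall>x\<in>V. \<forall>y\<in>V. f (x + y) = f x + f y) \<and> (\<forall>c. \<forall>x\<in>V. f (c *\<^sub>C x) = c *\<^sub>C f x)"

definition bounded_on :: "'a::real_normed_vector set \<Rightarrow> ('a \<Rightarrow> 'b::real_normed_vector) \<Rightarrow> bool" where
  "bounded_on V f \<longleftrightarrow> (\<exists>C. \<forall>x\<in>V. norm (f x) \<le> C * norm x)"

definition bounded_clinear :: "('a::complex_normed_vector \<Rightarrow> 'b::complex_normed_vector) \<Rightarrow> bool" where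
  "bounded_clinear f \<longleftrightarrow> clinear_on UNIV f \<and> bounded_on UNIV f"


section \<open>Operators on a Hilbert space\<close>

text \<open>Elements of B(H) are functions satisfying \<open>bounded_clinear\<close>.\<close>

definition is_adjoint :: "('a::complex_inner \<Rightarrow> 'b::complex_inner) \<Rightarrow> ('b \<Rightarrow> 'a) \<Rightarrow> bool" where
  "is_adjoint T T' \<longleftrightarrow> (\<forall>x y. cinner (T' x) y = cinner x (T y))"

definition selfadjoint :: "('a::complex_inner \<Rightarrow> 'a) \<Rightarrow> bool" where
  "selfadjoint T \<longleftrightarrow> is_adjoint T T"

definition op_le :: "('a::complex_inner \<Rightarrow> 'a) \<Rightarrow> ('a \<Rightarrow> 'a) \<Rightarrow> bool" where
  "op_le A B \<longleftrightarrow> (\<forall>x. cinner x (B x - A x) \<in> \<real>\<^sub>\<ge>\<^sub>0)"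

definition is_onb :: "'a::complex_inner set \<Rightarrow> bool" where
  "is_onb E \<longleftrightarrow> (\<forall>e\<in>E. \<forall>f\<in>E. cinner e f = (if e = f then 1 else 0)) \<and>
     (\<forall>x. (\<forall>e\<in>E. cinner e x = 0) \<longrightarrow> x = 0)"

text \<open>\<open>is_abs_op T P\<close> says that \<open>P\<close> is the positive square root of \<open>T\<^sup>*T\<close>.\<close>

definition is_abs_op :: "('a::complex_inner \<Rightarrow> 'a) \<Rightarrow> ('a \<Rightarrow> 'a) \<Rightarrow> bool" where
  "is_abs_op T P \<longleftrightarrow> bounded_clinear P \<and> op_le (\<lambda>x. 0) P \<and>
     (\<exists>T'. is_adjoint T T' \<and> P \<circ> P = T' \<circ> T)"

definition trace_class :: "('a::complex_inner \<Rightarrow> 'a) \<Rightarrow> bool" where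
  "trace_class T \<longleftrightarrow> bounded_clinear T \<and>
     (\<exists>P E. is_abs_op T P \<and> is_onb E \<and> (\<lambda>e. cinner e (P e)) summable_on E)"

definition antiunitary_involution :: "('a::complex_inner \<Rightarrow> 'a) \<Rightarrow> bool" where
  "antiunitary_involution \<Gamma> \<longleftrightarrow>
     (\<forall>x y. \<Gamma> (x + y) = \<Gamma> x + \<Gamma> y) \<and> (\<forall>c x. \<Gamma> (c *\<^sub>C x) = cnj c *\<^sub>C \<Gamma> x) \<and>
     (\<forall>x y. cinner (\<Gamma> x) (\<Gamma> y) = cinner y x) \<and> (\<forall>x. \<Gamma> (\<Gamma> x) = x)"


section \<open>Von Neumann algebras and normal functionals\<close>

definition commutant :: "('a::complex_inner \<Rightarrow> 'a) set \<Rightarrow> ('a \<Rightarrow> 'a) set" where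
  "commutant M = {T. bounded_clinear T \<and> (\<forall>A\<in>M. T \<circ> A = A \<circ> T)}"

definition ultraweak_topology :: "('a::complex_inner \<Rightarrow> 'a) topology" where
  "ultraweak_topology = topology_generated_by
     {{T. bounded_clinear T \<and> (\<Sum>n. cinner (\<xi> n) (T (\<eta> n))) \<in> U} | \<xi> \<eta> U.
        summable (\<lambda>n::nat. (norm (\<xi> n))\<^sup>2) \<and> summable (\<lambda>n. (norm (\<eta> n))\<^sup>2) \<and> open U}"

text \<open>The functional need not be positive, so normality means ultraweak continuity.
  Linearity is spelled out because the operators are plain functions.\<close>

definition normal_functional ::
    "('a::complex_inner \<Rightarrow> 'a) set \<Rightarrow> (('a \<Rightarrow> 'a) \<Rightarrow> complex) \<Rightarrow> bool" where
  "normal_functional M \<psi> \<longleftrightarrow>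
     (\<forall>A\<in>M. \<forall>B\<in>M. \<psi> (\<lambda>x. A x + B x) = \<psi> A + \<psi> B) \<and>
     (\<forall>c. \<forall>A\<in>M. \<psi> (\<lambda>x. c *\<^sub>C A x) = c * \<psi> A) \<and>
     continuous_map (subtopology ultraweak_topology M) euclidean \<psi>"


section \<open>States, representations, GNS triples\<close>

definition is_state :: "('a::unital_cstar_algebra \<Rightarrow> complex) \<Rightarrow> bool" where
  "is_state \<phi> \<longleftrightarrow> clinear_on UNIV \<phi> \<and> \<phi> 1 = 1 \<and> (\<forall>a. \<phi> (star a * a) \<in> \<real>\<^sub>\<ge>\<^sub>0)"

definition is_representation ::
    "('a::unital_cstar_algebra \<Rightarrow> 'h::chilbert_space \<Rightarrow> 'h) \<Rightarrow> bool" where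
  "is_representation \<pi> \<longleftrightarrow>
     (\<forall>a. bounded_clinear (\<pi> a)) \<and> \<pi> 1 = id \<and>
     (\<forall>a b. \<pi> (a + b) = (\<lambda>x. \<pi> a x + \<pi> b x)) \<and>
     (\<forall>c a. \<pi> (c *\<^sub>C a) = (\<lambda>x. c *\<^sub>C \<pi> a x)) \<and>
     (\<forall>a b. \<pi> (a * b) = \<pi> a \<circ> \<pi> b) \<and>
     (\<forall>a. is_adjoint (\<pi> a) (\<pi> (star a)))"

text \<open>The GNS triple of a state is determined by these properties up to unitary equivalence.\<close>

definition is_GNS ::
    "('a::unital_cstar_algebra \<Rightarrow> complex) \<Rightarrow> ('a \<Rightarrow> 'h::chilbert_space \<Rightarrow> 'h) \<Rightarrow> 'h \<Rightarrow> bool" where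
  "is_GNS \<phi> \<pi> \<Omega> \<longleftrightarrow> is_representation \<pi> \<and>
     closure (range (\<lambda>a. \<pi> a \<Omega>)) = UNIV \<and> (\<forall>a. \<phi> a = cinner \<Omega> (\<pi> a \<Omega>))"

definition normal_in_rep ::
    "('a::unital_cstar_algebra \<Rightarrow> 'h::chilbert_space \<Rightarrow> 'h) \<Rightarrow> ('a \<Rightarrow> complex) \<Rightarrow> bool" where
  "normal_in_rep \<pi> \<phi> \<longleftrightarrow>
     (\<exists>\<psi>. normal_functional (commutant (commutant (range \<pi>))) \<psi> \<and> (\<forall>a. \<phi> a = \<psi> (\<pi> a)))"


section \<open>The selfdual CAR algebra\<close>

inductive_set star_alg :: "'a::unital_cstar_algebra set \<Rightarrow> 'a set" for G where
  star_alg_gen: "a \<in> G \<Longrightarrow> a \<in> star_alg G"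
| star_alg_one: "1 \<in> star_alg G"
| star_alg_add: "a \<in> star_alg G \<Longrightarrow> b \<in> star_alg G \<Longrightarrow> a + b \<in> star_alg G"
| star_alg_scaleC: "a \<in> star_alg G \<Longrightarrow> c *\<^sub>C a \<in> star_alg G"
| star_alg_mult: "a \<in> star_alg G \<Longrightarrow> b \<in> star_alg G \<Longrightarrow> a * b \<in> star_alg G"
| star_alg_star: "a \<in> star_alg G \<Longrightarrow> star a \<in> star_alg G"

text \<open>Elements of the free *-algebra on the symbols \<open>f \<in> K\<close> are finitely supported functions
  from words to coefficients. The involution maps the generator \<open>f\<close> to \<open>\<Gamma> f\<close>.\<close>

definition nc_poly :: "('k list \<Rightarrow> complex) set" where
  "nc_poly = {p. finite {w. p w \<noteq> 0}}"

definition nc_word :: "'k list \<Rightarrow> 'k list \<Rightarrow> complex" where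
  "nc_word w = (\<lambda>v. if v = w then 1 else 0)"

definition nc_mult :: "('k list \<Rightarrow> complex) \<Rightarrow> ('k list \<Rightarrow> complex) \<Rightarrow> 'k list \<Rightarrow> complex" where
  "nc_mult p q = (\<lambda>w. \<Sum>i\<le>length w. p (take i w) * q (drop i w))"

definition nc_star :: "('k \<Rightarrow> 'k) \<Rightarrow> ('k list \<Rightarrow> complex) \<Rightarrow> 'k list \<Rightarrow> complex" where
  "nc_star \<Gamma> p = (\<lambda>w. cnj (p (rev (map \<Gamma> w))))"

definition nc_eval ::
    "('k \<Rightarrow> 'a::unital_cstar_algebra) \<Rightarrow> ('k list \<Rightarrow> complex) \<Rightarrow> 'a" where
  "nc_eval F p = (\<Sum>w | p w \<noteq> 0. p w *\<^sub>C prod_list (map F w))"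

text \<open>C*-seminorms on the free *-algebra that vanish on the relations (linearity of the generators
  and the anticommutation relations). Such a seminorm vanishes on the two-sided ideal they
  generate, so these are the C*-seminorms on the *-algebra presented by the relations.\<close>

definition CAR_seminorm ::
    "('k::complex_inner \<Rightarrow> 'k) \<Rightarrow> (('k list \<Rightarrow> complex) \<Rightarrow> real) \<Rightarrow> bool" where
  "CAR_seminorm \<Gamma> N \<longleftrightarrow>
     (\<forall>p\<in>nc_poly. \<forall>q\<in>nc_poly. N (\<lambda>w. p w + q w) \<le> N p + N q) \<and>
     (\<forall>c. \<forall>p\<in>nc_poly. N (\<lambda>w. c * p w) = cmod c * N p) \<and>
     (\<forall>p\<in>nc_poly. \<forall>q\<in>nc_poly. N (nc_mult p q) \<le> N p * N q) \<and>
     (\<forall>p\<in>nc_poly. N (nc_mult (nc_star \<Gamma> p) p) = (N p)\<^sup>2) \<and>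
     (\<forall>a b f g. N (\<lambda>w. nc_word [a *\<^sub>C f + b *\<^sub>C g] w
        - (a * nc_word [f] w + b * nc_word [g] w)) = 0) \<and>
     (\<forall>f g. N (\<lambda>w. nc_word [\<Gamma> f, g] w + nc_word [g, \<Gamma> f] w - cinner f g * nc_word [] w) = 0)"

text \<open>The last clause says that the algebra is the universal C*-algebra for the relations: its norm
  dominates (hence is the largest of) all C*-seminorms compatible with them. It excludes
  proper quotients, such as those of the Clifford algebras on odd-dimensional spaces, on which
  quasi-free functionals do not exist.\<close>

definition is_selfdual_CAR ::
    "('k::chilbert_space \<Rightarrow> 'k) \<Rightarrow> ('k \<Rightarrow> 'a::unital_cstar_algebra) \<Rightarrow> bool" where
  "is_selfdual_CAR \<Gamma> F \<longleftrightarrow>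
     clinear_on UNIV F \<and>
     (\<forall>f. star (F f) = F (\<Gamma> f)) \<and>
     (\<forall>f g. star (F f) * F g + F g * star (F f) = cinner f g *\<^sub>C 1) \<and>
     closure (star_alg (range F)) = UNIV \<and>
     (\<forall>N. CAR_seminorm \<Gamma> N \<longrightarrow> (\<forall>p\<in>nc_poly. N p \<le> norm (nc_eval F p)))"


section \<open>Quasi-free functionals\<close>

text \<open>The values of \<open>\<phi>\<close> outside the *-algebra generated by the \<open>F f\<close> are irrelevant. In the last
  clause \<open>fs ! j\<close> is the factor number \<open>j + 2\<close> of the monomial, and \<open>(-1) ^ (j + 2) = (-1) ^ j\<close>.\<close>

definition is_quasi_free ::
    "('k::chilbert_space \<Rightarrow> 'a::unital_cstar_algebra) \<Rightarrow> ('k \<Rightarrow> 'k) \<Rightarrow> ('a \<Rightarrow> complex) \<Rightarrow> bool" where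
  "is_quasi_free F S \<phi> \<longleftrightarrow>
     clinear_on (star_alg (range F)) \<phi> \<and> \<phi> 1 = 1 \<and>
     (\<forall>fs. odd (length fs) \<longrightarrow> \<phi> (prod_list (map F fs)) = 0) \<and>
     (\<forall>f g. \<phi> (star (F f) * F g) = cinner f (S g)) \<and>
     (\<forall>f fs. odd (length fs) \<longrightarrow> \<phi> (prod_list (map F (f # fs))) =
        (\<Sum>j<length fs. (-1) ^ j * \<phi> (F f * F (fs ! j)) *
           \<phi> (prod_list (map F (take j fs @ drop (Suc j) fs)))))"

end

(*
On the CAR algebra the contraction with a vector is an inner graded derivation, hence bounded:
for a of parity s it is a |-> F u * a - s a * F u. A perturbation T = S - R of the two-point
function acts on quasi-free functionals as phi_S = phi_R o exp(Delta), where Delta is the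
second-order operator -1/2 sum_k (contraction with y_k)(contraction with Gamma w_k) for a
decomposition T = sum_k |y_k><w_k|. If T is trace class, the decomposition can be chosen with
sum_k |y_k| |w_k| finite, so Delta is bounded. Moreover Delta is an absolutely convergent sum of
maps a |-> b * a * c, and composing with these maps turns a series of vector functionals of the GNS
representation into another one; hence phi_S is such a series, that is, bounded and normal.
*)

theory Submission
  imports Defs
begin

text \<open>Since S need not lie between 0 and 1, phi_S need not be positive, so neither the
  automatic boundedness of states nor a comparison of GNS representations of two states is
  available; the bound has to come from a convergent formula. The exponential formula holds because
  Delta commutes with every contraction, while its commutator with left multiplication by F f is
  minus the contraction with T f. Iterated commutators therefore vanish, and moving F f out of
  exp(Delta) replaces the vector f - R f in Wick's recursion by f - R f - T f = f - S f. The
  decomposition of T is read off from a Cholesky factorization of |T| along an orthonormal basis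
  with summable diagonal, so that no spectral decomposition is involved.\<close>

instance chilbert_space \<subseteq> banach ..
instance unital_cstar_algebra \<subseteq> banach ..

section \<open>Complex vector spaces and inner products\<close>

lemma scaleC_one [simp]: "1 *\<^sub>C (x::'a::complex_vector) = x"
  using scaleC_of_real[of 1 x] by simp

lemma scaleC_zero_left [simp]: "0 *\<^sub>C (x::'a::complex_vector) = 0"
  using scaleC_of_real[of 0 x] by simp

lemma scaleC_zero_right [simp]: "c *\<^sub>C (0::'a::complex_vector) = 0"
  using scaleC_add_right[of c 0 "0::'a"] by simp

lemma scaleC_minus_left: "(- c) *\<^sub>C (x::'a::complex_vector) = - (c *\<^sub>C x)"
  using scaleC_add_left[of "-c" c x] by (simp add: eq_neg_iff_add_eq_0)

lemma scaleC_minus_right: "c *\<^sub>C (- (x::'a::complex_vector)) = - (c *\<^sub>C x)"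
  using scaleC_add_right[of c "-x" x] by (simp add: eq_neg_iff_add_eq_0)

lemma scaleC_diff_right: "c *\<^sub>C (x - y::'a::complex_vector) = c *\<^sub>C x - c *\<^sub>C y"
  using scaleC_add_right[of c x "-y"] by (simp add: scaleC_minus_right)

lemma scaleC_scaleR: "c *\<^sub>C r *\<^sub>R (x::'a::complex_vector) = r *\<^sub>R c *\<^sub>C x"
  by (simp add: scaleC_scaleC mult.commute flip: scaleC_of_real)

lemma bounded_linear_scaleC_right: "bounded_linear (\<lambda>x::'a::complex_normed_vector. c *\<^sub>C x)"
  by (rule bounded_linear_intro[of _ "cmod c"])
     (simp_all add: scaleC_add_right scaleC_scaleR norm_scaleC mult.commute)

lemma bounded_clinear_add: "bounded_clinear f \<Longrightarrow> f (x + y) = f x + f y"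
  by (simp add: bounded_clinear_def clinear_on_def)

lemma bounded_clinear_scaleC: "bounded_clinear f \<Longrightarrow> f (c *\<^sub>C x) = c *\<^sub>C f x"
  by (simp add: bounded_clinear_def clinear_on_def)

lemma bounded_clinear_scaleR: "bounded_clinear f \<Longrightarrow> f (r *\<^sub>R x) = r *\<^sub>R f x"
  by (simp add: bounded_clinear_scaleC flip: scaleC_of_real)

lemma bounded_clinear_imp_bounded_linear:
  assumes "bounded_clinear f" shows "bounded_linear f"
proof -
  obtain C where "norm (f x) \<le> C * norm x" for x
    using assms by (auto simp: bounded_clinear_def bounded_on_def)
  then show ?thesis
    by (intro bounded_linear_intro[of _ C])
       (auto simp: bounded_clinear_add[OF assms] bounded_clinear_scaleR[OF assms] mult.commute)
qed

lemma bounded_clinearI: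
  assumes "bounded_linear f" and "\<And>c x. f (c *\<^sub>C x) = c *\<^sub>C f x"
  shows "bounded_clinear f"
proof -
  obtain K where "\<And>x. norm (f x) \<le> norm x * K"
    using bounded_linear.bounded[OF assms(1)] by blast
  then have "\<exists>C. \<forall>x. norm (f x) \<le> C * norm x" by (auto simp: mult.commute)
  then show ?thesis
    unfolding bounded_clinear_def clinear_on_def bounded_on_def
    using assms(2) by (auto simp: linear_add[OF bounded_linear.linear[OF assms(1)]])
qed

lemma cinner_scaleC_left: "cinner (c *\<^sub>C x) y = cnj c * cinner x y"
  using cinner_commute[of "c *\<^sub>C x" y] cinner_commute[of x y] by (simp add: cinner_scaleC_right)

lemma cinner_add_left: "cinner (x + y) z = cinner x z + cinner y z"
  using cinner_commute[of "x + y" z] cinner_commute[of x z] cinner_commute[of y z]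
  by (simp add: cinner_add_right)

lemma cinner_zero_right [simp]: "cinner x 0 = 0"
  using cinner_scaleC_right[of x 0 0] by simp

lemma cinner_zero_left [simp]: "cinner 0 x = 0"
  using cinner_scaleC_left[of 0 0 x] by simp

lemma cinner_minus_right: "cinner x (- y) = - cinner x y"
  using cinner_scaleC_right[of x "-1" y] by (simp add: scaleC_minus_left)

lemma cinner_minus_left: "cinner (- x) y = - cinner x y"
  using cinner_scaleC_left[of "-1" x y] by (simp add: scaleC_minus_left)

lemma cinner_diff_right: "cinner x (y - z) = cinner x y - cinner x z"
  using cinner_add_right[of x y "-z"] by (simp add: cinner_minus_right)

lemma cinner_diff_left: "cinner (x - y) z = cinner x z - cinner y z"
  using cinner_add_left[of x "-y" z] by (simp add: cinner_minus_left)

lemma cinner_scaleR_right: "cinner x (r *\<^sub>R y) = of_real r * cinner x y"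
  using cinner_scaleC_right[of x "of_real r" y] by (simp add: scaleC_of_real)

lemma cinner_scaleR_left: "cinner (r *\<^sub>R x) y = of_real r * cinner x y"
  using cinner_scaleC_left[of "of_real r" x y] by (simp add: scaleC_of_real)

lemma cinner_sum_right: "cinner x (\<Sum>i\<in>A. f i) = (\<Sum>i\<in>A. cinner x (f i))"
  by (induction A rule: infinite_finite_induct) (auto simp: cinner_add_right)

lemma cinner_self_eq_norm: "Re (cinner x x) = (norm x)\<^sup>2"
  by (simp add: cinner_self)

section \<open>Positive operators and the Cauchy-Schwarz inequality\<close>

definition pos_op :: "('a::complex_inner \<Rightarrow> 'a) \<Rightarrow> bool" where
  "pos_op A \<longleftrightarrow> clinear_on UNIV A \<and> (\<forall>x. cinner x (A x) \<in> \<real>\<^sub>\<ge>\<^sub>0)"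

context
  fixes A :: "'a::complex_inner \<Rightarrow> 'a"
  assumes A: "pos_op A"
begin

lemma pos_op_add: "A (x + y) = A x + A y"
  using A by (simp add: pos_op_def clinear_on_def)

lemma pos_op_scaleC: "A (c *\<^sub>C x) = c *\<^sub>C A x"
  using A by (simp add: pos_op_def clinear_on_def)

lemma pos_op_nonneg: "0 \<le> Re (cinner x (A x))"
  using A by (simp add: pos_op_def complex_nonneg_Reals_iff)

lemma pos_op_Im: "Im (cinner x (A x)) = 0"
  using A by (simp add: pos_op_def complex_nonneg_Reals_iff)

text \<open>Polarization: reality of the quadratic form at \<open>x + y\<close> gives the imaginary
  part of the identity, and at \<open>x + \<i> *\<^sub>C y\<close> the real part.\<close>

lemma pos_op_selfadjoint: "cinner (A x) y = cinner x (A y)"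
proof -
  have 1: "Im (cinner x (A y)) + Im (cinner y (A x)) = 0" for x y
    using pos_op_Im[of "x + y"] pos_op_Im[of x] pos_op_Im[of y]
    by (simp add: pos_op_add cinner_add_left cinner_add_right)
  have 2: "Re (cinner x (A y)) - Re (cinner y (A x)) = 0"
    using 1[of x "\<i> *\<^sub>C y"]
    by (simp add: pos_op_scaleC cinner_scaleC_left cinner_scaleC_right)
  have "cinner x (A y) = cnj (cinner y (A x))"
    using 1[of x y] 2 by (simp add: complex_eq_iff)
  then show ?thesis by (metis cinner_commute)
qed

lemma pos_op_Cauchy_Schwarz:
  "(cmod (cinner x (A y)))\<^sup>2 \<le> Re (cinner x (A x)) * Re (cinner y (A y))"
proof -
  define b where "b = cinner x (A y)"
  define p q where "p = Re (cinner x (A x))" and "q = Re (cinner y (A y))"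
  have yx: "cinner y (A x) = cnj b"
    unfolding b_def by (metis cinner_commute pos_op_selfadjoint)
  \<comment> \<open>The coefficient \<open>- t * b\<close> of \<open>x\<close> absorbs the phase of
    \<open>b\<close> and leaves a real quadratic in \<open>t\<close>. It is evaluated at
    \<open>1 / p\<close>, or for \<open>p = 0\<close> at a \<open>t\<close> so large that the linear
    term wins.\<close>
  have key: "0 \<le> t\<^sup>2 * (cmod b)\<^sup>2 * p - 2 * t * (cmod b)\<^sup>2 + q" for t :: real
  proof -
    let ?c = "- of_real t * b"
    have "cinner (?c *\<^sub>C x + y) (A (?c *\<^sub>C x + y)) =
        cnj ?c * ?c * cinner x (A x) + cnj ?c * b + ?c * cnj b + cinner y (A y)"
      by (simp add: pos_op_add pos_op_scaleC cinner_add_left cinner_add_right cinner_scaleC_left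
          cinner_scaleC_right b_def[symmetric] yx algebra_simps)
    moreover have bb: "cnj b * b = of_real ((cmod b)\<^sup>2)"
      by (metis complex_norm_square mult.commute)
    moreover have "cnj ?c * ?c = of_real (t\<^sup>2 * (cmod b)\<^sup>2)"
    proof -
      have "cnj ?c * ?c = of_real t * of_real t * (cnj b * b)" by (simp add: mult_ac)
      also have "\<dots> = of_real (t\<^sup>2 * (cmod b)\<^sup>2)"
        unfolding bb by (simp add: power2_eq_square)
      finally show ?thesis .
    qed
    moreover have "cnj ?c * b = of_real (- t * (cmod b)\<^sup>2)" "?c * cnj b = of_real (- t * (cmod b)\<^sup>2)"
      using bb by (simp_all del: of_real_power add: mult.assoc mult.commute[of b])
    ultimately have "cinner (?c *\<^sub>C x + y) (A (?c *\<^sub>C x + y)) =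
        of_real (t\<^sup>2 * (cmod b)\<^sup>2) * cinner x (A x) + of_real (- t * (cmod b)\<^sup>2)
        + of_real (- t * (cmod b)\<^sup>2) + cinner y (A y)"
      by (simp only:)
    then have "Re (cinner (?c *\<^sub>C x + y) (A (?c *\<^sub>C x + y))) =
        t\<^sup>2 * (cmod b)\<^sup>2 * p - 2 * t * (cmod b)\<^sup>2 + q"
      by (simp add: p_def q_def del: of_real_mult of_real_power)
    then show ?thesis using pos_op_nonneg[of "?c *\<^sub>C x + y"] by simp
  qed
  have p: "0 \<le> p" and q: "0 \<le> q" unfolding p_def q_def by (rule pos_op_nonneg)+
  have "(cmod b)\<^sup>2 \<le> p * q"
  proof (cases "p = 0")
    case True
    show ?thesis
    proof (rule ccontr)
      assume "\<not> ?thesis"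
      then have "0 < (cmod b)\<^sup>2" using True by simp
      moreover from this have "0 \<le> q - 2 * (q + 1)"
        using key[of "(q + 1) / (cmod b)\<^sup>2"] True by simp
      ultimately show False using q by (simp split: if_splits)
    qed
  next
    case False
    then have "0 < p" using p by simp
    then show ?thesis using key[of "1 / p"] by (simp add: field_simps power2_eq_square)
  qed
  then show ?thesis by (simp add: b_def p_def q_def)
qed

text \<open>Cauchy-Schwarz for the pair \<open>A x\<close>, \<open>x\<close> bounds the fourth power
  of \<open>norm (A x)\<close> by zero.\<close>

lemma pos_op_null: "Re (cinner x (A x)) = 0 \<Longrightarrow> A x = 0"
  using pos_op_Cauchy_Schwarz[of "A x" x] cinner_self[of "A x"]
  by simp

end

lemma pos_op_id: "pos_op (\<lambda>x. x)"
  by (simp add: pos_op_def clinear_on_def cinner_self complex_nonneg_Reals_iff del: of_real_power)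

lemma cinner_Cauchy_Schwarz: "cmod (cinner x y) \<le> norm x * norm y"
  using pos_op_Cauchy_Schwarz[OF pos_op_id, of x y]
  unfolding cinner_self_eq_norm power_mult_distrib[symmetric] by (rule power2_le_imp_le) simp

lemma bounded_linear_cinner_right: "bounded_linear (\<lambda>x. cinner y x)"
  by (rule bounded_linear_intro[of _ "norm y"])
     (simp_all add: cinner_add_right cinner_scaleR_right scaleR_conv_of_real,
      metis cinner_Cauchy_Schwarz mult.commute)

lemma norm_diff_sq: "(norm (x - y :: 'a::complex_inner))\<^sup>2
    = (norm x)\<^sup>2 - 2 * Re (cinner x y) + (norm y)\<^sup>2"
proof -
  have "Re (cinner y x) = Re (cinner x y)" using cinner_commute[of x y] by simp
  then show ?thesis
    unfolding cinner_self_eq_norm[symmetric] by (simp add: cinner_diff_left cinner_diff_right)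
qed

section \<open>Rank-one decomposition of trace-class operators\<close>

locale orthonormal_seq =
  fixes e :: "nat \<Rightarrow> 'a::chilbert_space"
  assumes orth: "i \<noteq> j \<Longrightarrow> cinner (e i) (e j) = 0"
    and unit_or_zero: "e i = 0 \<or> norm (e i) = 1"
begin

definition proj :: "nat set \<Rightarrow> 'a \<Rightarrow> 'a" where
  "proj I x = (\<Sum>i\<in>I. cinner (e i) x *\<^sub>C e i)"

lemma cinner_e_self: "cinner (e i) x * cinner (e i) (e i) = cinner (e i) x"
  using unit_or_zero[of i] by (auto simp: cinner_self)

lemma cinner_e_sum: "finite I \<Longrightarrow> j \<in> I \<Longrightarrow> cinner (e j) (proj I x) = cinner (e j) x"
  unfolding proj_def cinner_sum_right cinner_scaleC_right
  by (subst sum.remove[of _ j]) (auto simp: cinner_e_self orth intro!: sum.neutral)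

lemma norm_proj: "finite I \<Longrightarrow> (norm (proj I x))\<^sup>2 = (\<Sum>i\<in>I. (cmod (cinner (e i) x))\<^sup>2)"
  and Re_cinner_proj: "finite I \<Longrightarrow> Re (cinner x (proj I x)) = (\<Sum>i\<in>I. (cmod (cinner (e i) x))\<^sup>2)"
proof -
  assume I: "finite I"
  have eq: "cinner y (proj I x) = (\<Sum>i\<in>I. cinner (e i) x * cnj (cinner (e i) y))" for y
    unfolding proj_def cinner_sum_right cinner_scaleC_right by (metis cinner_commute)
  show "Re (cinner x (proj I x)) = (\<Sum>i\<in>I. (cmod (cinner (e i) x))\<^sup>2)"
    unfolding eq complex_norm_square[symmetric] by simp
  have "cinner (proj I x) (proj I x) = (\<Sum>i\<in>I. of_real ((cmod (cinner (e i) x))\<^sup>2))"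
    unfolding eq[of "proj I x"] complex_norm_square by (rule sum.cong) (simp_all add: cinner_e_sum I)
  then show "(norm (proj I x))\<^sup>2 = (\<Sum>i\<in>I. (cmod (cinner (e i) x))\<^sup>2)"
    unfolding cinner_self_eq_norm[symmetric] by simp
qed

lemma norm_diff_proj:
  "finite I \<Longrightarrow> (norm (x - proj I x))\<^sup>2 = (norm x)\<^sup>2 - (\<Sum>i\<in>I. (cmod (cinner (e i) x))\<^sup>2)"
  by (simp add: norm_diff_sq norm_proj Re_cinner_proj)

lemma Bessel: "summable (\<lambda>i. (cmod (cinner (e i) x))\<^sup>2)"
proof (rule summableI_nonneg_bounded)
  show "(\<Sum>i<n. (cmod (cinner (e i) x))\<^sup>2) \<le> (norm x)\<^sup>2" for n
    using zero_le_power2[of "norm (x - proj {..<n} x)"] by (simp add: norm_diff_proj)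
qed simp

text \<open>Squared distances between the projections are differences of partial sums of the Bessel
  series.\<close>

lemma proj_convergent: "convergent (\<lambda>n. proj {..<n} x)"
proof -
  define S where "S n = (\<Sum>i<n. (cmod (cinner (e i) x))\<^sup>2)" for n
  have *: "(norm (proj {..<n} x - proj {..<m} x))\<^sup>2 = S n - S m" if "m \<le> n" for m n
  proof -
    have "proj {..<n} x - proj {..<m} x = proj {m..<n} x"
      and "S n - S m = (\<Sum>i=m..<n. (cmod (cinner (e i) x))\<^sup>2)"
      using that unfolding proj_def S_def lessThan_atLeast0 by (simp_all add: sum_diff_nat_ivl)
    then show ?thesis by (simp add: norm_proj)
  qed
  have "Cauchy S"
    using Bessel[of x] unfolding summable_iff_convergent S_def[symmetric]
    by (simp add: Cauchy_convergent_iff)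
  have "Cauchy (\<lambda>n. proj {..<n} x)"
  proof (rule CauchyI')
    fix r :: real assume r: "0 < r"
    then obtain M where M: "norm (S m - S n) < r\<^sup>2" if "m \<ge> M" "n \<ge> M" for m n
      using CauchyD[OF \<open>Cauchy S\<close>, of "r\<^sup>2"] by auto
    have "norm (proj {..<m} x - proj {..<n} x) < r" if "m \<ge> M" "m < n" for m n
    proof (rule power_less_imp_less_base)
      show "(norm (proj {..<m} x - proj {..<n} x))\<^sup>2 < r\<^sup>2"
        using *[of m n] M[of n m] that by (simp add: norm_minus_commute)
    qed (use r in simp)
    then show "\<exists>M. \<forall>m\<ge>M. \<forall>n>m. dist (proj {..<m} x) (proj {..<n} x) < r"
      by (auto simp: dist_norm)
  qed
  then show ?thesis by (simp add: Cauchy_convergent_iff)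
qed

text \<open>The hypothesis expresses, without closed spans, that a vector in the closed span of
  \<open>e\<close> and \<open>x\<close> which is orthogonal to all \<open>e i\<close> vanishes. It
  is used for \<open>x\<close> minus the limit of its projections, so completeness of
  \<open>e\<close> is required only relative to \<open>x\<close>.\<close>

lemma Parseval:
  assumes "\<And>y. (\<And>i. cinner (e i) y = 0) \<Longrightarrow> (\<And>z. (\<And>i. cinner z (e i) = 0) \<Longrightarrow> cinner z x = 0 \<Longrightarrow> cinner z y = 0)
     \<Longrightarrow> y = 0"
  shows "(\<lambda>i. (cmod (cinner (e i) x))\<^sup>2) sums (norm x)\<^sup>2"
proof -
  obtain y where y: "(\<lambda>n. proj {..<n} x) \<longlonglongrightarrow> y"
    using proj_convergent by (auto simp: convergent_def)
  have "x - y = 0"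
  proof (rule assms)
    fix j
    have "(\<lambda>n. cinner (e j) (proj {..<n} x)) \<longlonglongrightarrow> cinner (e j) y"
      by (rule bounded_linear.tendsto[OF bounded_linear_cinner_right y])
    moreover have "(\<lambda>n. cinner (e j) (proj {..<n} x)) \<longlonglongrightarrow> cinner (e j) x"
      by (rule tendsto_eventually, rule eventually_sequentiallyI[of "Suc j"]) (simp add: cinner_e_sum)
    ultimately show "cinner (e j) (x - y) = 0"
      by (auto simp: cinner_diff_right dest: LIMSEQ_unique)
  next
    fix z assume z: "\<And>i. cinner z (e i) = 0" "cinner z x = 0"
    have "(\<lambda>n. cinner z (proj {..<n} x)) \<longlonglongrightarrow> cinner z y"
      by (rule bounded_linear.tendsto[OF bounded_linear_cinner_right y])
    moreover have "cinner z (proj {..<n} x) = 0" for n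
      by (simp add: proj_def cinner_sum_right cinner_scaleC_right z)
    ultimately have "cinner z y = 0" by (simp add: LIMSEQ_const_iff)
    then show "cinner z (x - y) = 0" by (simp add: cinner_diff_right z)
  qed
  then have "(\<lambda>n. (norm (x - proj {..<n} x))\<^sup>2) \<longlonglongrightarrow> (norm (x - x))\<^sup>2"
    using y by (intro tendsto_intros) simp
  then have "(\<lambda>n. (norm x)\<^sup>2 - (norm (x - proj {..<n} x))\<^sup>2) \<longlonglongrightarrow> (norm x)\<^sup>2 - 0"
    by (intro tendsto_intros) simp
  then show ?thesis by (simp add: norm_diff_proj sums_def)
qed

end

text \<open>Gram--Schmidt for the semi-inner product \<open>cinner x (P y)\<close>: if the first \<open>n\<close> vectors of the
  sequence \<open>e\<close> yield \<open>z\<^sub>0, \<dots>, z\<^sub>n\<^sub>-\<^sub>1\<close>, then \<open>gs_residual P e n x = x - (\<Sum>i<n. cinner (P z\<^sub>i) x *\<^sub>C z\<^sub>i)\<close>.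
  Applying \<open>P\<close> gives the Cholesky residual of \<open>P\<close>. When \<open>e\<^sub>n\<close> is degenerate, division by zero makes
  \<open>z\<^sub>n = 0\<close>.\<close>

primrec gs_residual :: "('a::complex_inner \<Rightarrow> 'a) \<Rightarrow> (nat \<Rightarrow> 'a) \<Rightarrow> nat \<Rightarrow> 'a \<Rightarrow> 'a" where
  "gs_residual P e 0 = (\<lambda>x. x)"
| "gs_residual P e (Suc n) =
    (let r = gs_residual P e n; z = (1 / sqrt (Re (cinner (e n) (P (r (e n)))))) *\<^sub>R r (e n)
     in (\<lambda>x. r x - cinner (P z) x *\<^sub>C z))"

definition gs_vector :: "('a::complex_inner \<Rightarrow> 'a) \<Rightarrow> (nat \<Rightarrow> 'a) \<Rightarrow> nat \<Rightarrow> 'a" where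
  "gs_vector P e n = (1 / sqrt (Re (cinner (e n) (P (gs_residual P e n (e n)))))) *\<^sub>R
     gs_residual P e n (e n)"

lemma gs_residual_Suc:
  "gs_residual P e (Suc n) x =
    gs_residual P e n x - cinner (P (gs_vector P e n)) x *\<^sub>C gs_vector P e n"
  by (simp add: gs_vector_def Let_def)

declare gs_residual.simps(2) [simp del]

lemma gs_residual_eq:
  "gs_residual P e n x = x - (\<Sum>i<n. cinner (P (gs_vector P e i)) x *\<^sub>C gs_vector P e i)"
proof (induction n)
  case (Suc n)
  then show ?case by (simp only: gs_residual_Suc) simp
qed simp

text \<open>One step replaces the positive operator \<open>A\<close> by its Schur complement at
  \<open>e n\<close>. Cauchy-Schwarz for \<open>A\<close> says that the subtracted rank-one form is
  dominated by that of \<open>A\<close>, and the subtraction annihilates \<open>e n\<close>. Earlier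
  null vectors stay null by selfadjointness of \<open>A\<close>. If the pivot \<open>d\<close> is
  zero, then \<open>A (e n) = 0\<close> and nothing is subtracted.\<close>

lemma
  assumes P: "pos_op P"
  shows pos_op_gs_residual: "pos_op (\<lambda>x. P (gs_residual P e n x))"
    and gs_residual_null: "j < n \<Longrightarrow> P (gs_residual P e n (e j)) = 0"
proof -
  have "pos_op (\<lambda>x. P (gs_residual P e n x)) \<and> (\<forall>j<n. P (gs_residual P e n (e j)) = 0)"
  proof (induction n)
    case 0
    then show ?case using P by simp
  next
    case (Suc n)
    define A where "A x = P (gs_residual P e n x)" for x
    have A: "pos_op A" "\<And>j. j < n \<Longrightarrow> A (e j) = 0" using Suc by (auto simp: A_def[abs_def])
    define d where "d = Re (cinner (e n) (A (e n)))"
    have dpos: "0 \<le> d" unfolding d_def by (rule pos_op_nonneg[OF A(1)])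
    have d: "cinner (e n) (A (e n)) = of_real d"
      using pos_op_Im[OF A(1), of "e n"] by (simp add: d_def complex_eq_iff)
    have lin: "P (x + y) = P x + P y" "P (c *\<^sub>C x) = c *\<^sub>C P x" "P (r *\<^sub>R x) = r *\<^sub>R P x" for x y c r
      using P by (simp_all add: pos_op_def clinear_on_def flip: scaleC_of_real)
    have Pd: "P (x - y) = P x - P y" for x y
      using lin(1)[of "x - y" y] by simp
    have Pz: "P (gs_vector P e n) = (1 / sqrt d) *\<^sub>R A (e n)"
      by (simp add: gs_vector_def lin A_def d_def)
    have step: "P (gs_residual P e (Suc n) x) = A x - (cinner (A (e n)) x / of_real d) *\<^sub>C A (e n)" for x
    proof -
      have "cinner (P (gs_vector P e n)) x *\<^sub>C P (gs_vector P e n) =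
          (cinner (A (e n)) x * of_real (1 / sqrt d * (1 / sqrt d))) *\<^sub>C A (e n)"
        unfolding Pz
        by (simp only: cinner_scaleR_left scaleC_scaleC of_real_mult mult_ac scaleC_of_real[symmetric]
            cinner_scaleC_left complex_cnj_complex_of_real)
      also have "1 / sqrt d * (1 / sqrt d) = 1 / d" using dpos by (simp flip: real_sqrt_mult)
      finally show ?thesis unfolding gs_residual_Suc by (simp add: Pd lin A_def)
    qed
    have "A (e n) = 0" if "d = 0" using pos_op_null[OF A(1), of "e n"] that by (simp add: d_def)
    then have null: "P (gs_residual P e (Suc n) (e n)) = 0"
      using d by (cases "d = 0") (simp_all add: step pos_op_selfadjoint[OF A(1)])
    have null': "P (gs_residual P e (Suc n) (e j)) = 0" if "j < n" for j
      using A(2)[OF that] by (simp add: step pos_op_selfadjoint[OF A(1)])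
    have "cinner x (P (gs_residual P e (Suc n) x)) \<in> \<real>\<^sub>\<ge>\<^sub>0" for x
    proof -
      have "cinner (A (e n)) x * cinner x (A (e n)) = of_real ((cmod (cinner x (A (e n))))\<^sup>2)"
        by (metis cinner_commute complex_norm_square mult.commute)
      then have "cinner x (P (gs_residual P e (Suc n) x)) =
          cinner x (A x) - of_real ((cmod (cinner x (A (e n))))\<^sup>2) / of_real d"
        by (simp add: step cinner_diff_right cinner_scaleC_right)
      also have "\<dots> = of_real (Re (cinner x (A x)) - (cmod (cinner x (A (e n))))\<^sup>2 / d)"
        using pos_op_Im[OF A(1), of x] by (simp add: complex_eq_iff del: of_real_power flip: of_real_divide)
      finally have "cinner x (P (gs_residual P e (Suc n) x)) =
          of_real (Re (cinner x (A x)) - (cmod (cinner x (A (e n))))\<^sup>2 / d)" .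
      moreover have "(cmod (cinner x (A (e n))))\<^sup>2 / d \<le> Re (cinner x (A x))"
        using pos_op_Cauchy_Schwarz[OF A(1), of x "e n"] dpos pos_op_nonneg[OF A(1), of x]
        by (cases "d = 0") (simp_all add: d_def[symmetric] field_simps)
      ultimately show ?thesis by (simp add: complex_nonneg_Reals_iff del: of_real_diff)
    qed
    moreover have "clinear_on UNIV (\<lambda>x. P (gs_residual P e (Suc n) x))"
      unfolding clinear_on_def step
      by (simp add: pos_op_add[OF A(1)] pos_op_scaleC[OF A(1)] cinner_add_right cinner_scaleC_right
          add_divide_distrib scaleC_add_left scaleC_diff_right scaleC_scaleC)
    ultimately have "pos_op (\<lambda>x. P (gs_residual P e (Suc n) x))" by (simp add: pos_op_def)
    moreover have "\<forall>j<Suc n. P (gs_residual P e (Suc n) (e j)) = 0"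
      using null null' by (simp add: less_Suc_eq)
    ultimately show ?case by blast
  qed
  then show "pos_op (\<lambda>x. P (gs_residual P e n x))"
    and "j < n \<Longrightarrow> P (gs_residual P e n (e j)) = 0" by auto
qed

text \<open>With \<open>P\<close> the absolute value of \<open>T\<close>, the remainder after
  \<open>n\<close> terms is \<open>T (r n x)\<close>, which has the same norm as the Cholesky
  residual \<open>P (r n x)\<close>. The same equality of norms, applied to the Gram-Schmidt vectors
  \<open>z k\<close>, makes the factors \<open>T (z k)\<close> and \<open>P (z k)\<close> equally
  long.\<close>

theorem trace_class_decomposition:
  fixes T :: "'a::chilbert_space \<Rightarrow> 'a"
  assumes "trace_class T"
  obtains w y where "\<And>k. norm (y k) = norm (w k)" and "summable (\<lambda>k::nat. (norm (w k))\<^sup>2)"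
    and "\<And>x. (\<lambda>k. cinner (w k) x *\<^sub>C y k) sums T x"
proof -
  obtain P E T' where T: "bounded_clinear T" and P: "bounded_clinear P" "op_le (\<lambda>x. 0) P"
    and T': "is_adjoint T T'" "P \<circ> P = T' \<circ> T"
    and E: "is_onb E" "(\<lambda>e. cinner e (P e)) summable_on E"
    using assms unfolding trace_class_def is_abs_op_def by blast
  have pos: "pos_op P" using P by (simp add: pos_op_def op_le_def bounded_clinear_def)
  note sa = pos_op_selfadjoint[OF pos]
  have norm_T: "norm (T x) = norm (P x)" for x
  proof -
    have "cinner (T x) (T x) = cinner (P x) (P x)"
      using T' by (metis comp_apply is_adjoint_def sa)
    then show ?thesis by (metis cinner_self_eq_norm norm_ge_zero power2_eq_imp_eq)
  qed
  have T_diff: "T (x - y) = T x - T y" for x y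
    using linear_diff[OF bounded_linear.linear, OF bounded_clinear_imp_bounded_linear[OF T]] .

  \<comment> \<open>Only countably many diagonal entries are nonzero, so these basis vectors can be
    enumerated; indices outside \<open>J\<close> get the vector 0.\<close>
  define E0 where "E0 = {e\<in>E. cinner e (P e) \<noteq> 0}"
  have "countable E0"
    unfolding E0_def by (rule summable_countable_complex[OF E(2)])
  define J where "J = to_nat_on E0 ` E0"
  define e where "e n = (if n \<in> J then from_nat_into E0 n else 0)" for n
  have e_to_nat: "e (to_nat_on E0 x) = x" if "x \<in> E0" for x
    using that \<open>countable E0\<close> by (simp add: e_def J_def)
  have e_cases: "e n = 0 \<or> e n \<in> E0 \<and> to_nat_on E0 (e n) = n" for n
    using \<open>countable E0\<close> by (auto simp: e_def J_def)
  have onb: "cinner x y = (if x = y then 1 else 0)" if "x \<in> E" "y \<in> E" for x y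
    using E(1) that by (simp add: is_onb_def)
  have E0E: "E0 \<subseteq> E" by (auto simp: E0_def)
  interpret orthonormal_seq e
  proof
    show "cinner (e i) (e j) = 0" if "i \<noteq> j" for i j
      using e_cases[of i] e_cases[of j] onb[of "e i" "e j"] E0E that
      by (cases "e i = e j") auto
    show "e i = 0 \<or> norm (e i) = 1" for i
    proof -
      have "norm (e i) = 1" if "e i \<in> E"
      proof -
        have "(norm (e i))\<^sup>2 = 1" using onb[OF that that] cinner_self_eq_norm[of "e i"] by simp
        then show ?thesis using power2_eq_imp_eq[of "norm (e i)" 1] by simp
      qed
      then show ?thesis using e_cases[of i] E0E by blast
    qed
  qed
  \<comment> \<open>Basis vectors outside \<open>E0\<close> lie in the kernel of \<open>P\<close>,
    hence are orthogonal to its range, so \<open>e\<close> is complete there.\<close>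
  have range_Parseval: "(\<lambda>i. (cmod (cinner (e i) (P x)))\<^sup>2) sums (norm (P x))\<^sup>2" for x
  proof (rule Parseval)
    fix y assume y: "\<And>i. cinner (e i) y = 0"
      "\<And>z. (\<And>i. cinner z (e i) = 0) \<Longrightarrow> cinner z (P x) = 0 \<Longrightarrow> cinner z y = 0"
    have "cinner z y = 0" if "z \<in> E" for z
    proof (cases "z \<in> E0")
      case True
      then show ?thesis using y(1) e_to_nat by metis
    next
      case False
      then have "Re (cinner z (P z)) = 0" using that by (simp add: E0_def)
      then have "P z = 0" by (rule pos_op_null[OF pos])
      then have "cinner z (P x) = 0" by (simp flip: sa)
      moreover have "cinner z (e i) = 0" for i
        using e_cases[of i] onb[OF that, of "e i"] False E0E by auto
      ultimately show ?thesis using y(2) by blast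
    qed
    then show "y = 0" using E(1) by (auto simp: is_onb_def)
  qed

  define h where "h n = Re (cinner (e n) (P (e n)))" for n
  have h0: "0 \<le> h n" for n unfolding h_def by (rule pos_op_nonneg[OF pos])
  have h: "summable h"
  proof -
    have "(\<lambda>x. Re (cinner x (P x))) summable_on E0"
      by (rule summable_on_Re, rule summable_on_subset_banach[OF E(2) E0E])
    then have "(\<lambda>n. h n) summable_on J"
      unfolding J_def using \<open>countable E0\<close>
      by (subst summable_on_reindex) (auto simp: o_def h_def e_to_nat inj_on_to_nat_on cong: summable_on_cong)
    then have "h summable_on UNIV"
      by (rule iffD1[OF summable_on_cong_neutral, rotated -1]) (auto simp: h_def e_def)
    then show ?thesis by (simp add: summable_on_UNIV_nonneg_real_iff h0)
  qed

  define z where "z = gs_vector P e"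
  define r where "r = gs_residual P e"
  have r_eq: "r n x = x - (\<Sum>i<n. cinner (P (z i)) x *\<^sub>C z i)" for n x
    unfolding r_def z_def by (rule gs_residual_eq)
  have A: "pos_op (\<lambda>x. P (r n x))" for n unfolding r_def by (rule pos_op_gs_residual[OF pos])
  have A0: "P (r n (e j)) = 0" if "j < n" for n j
    unfolding r_def by (rule gs_residual_null[OF pos that])
  have P_diff: "P (x - y) = P x - P y" for x y
    using linear_diff[OF bounded_linear.linear, OF bounded_clinear_imp_bounded_linear[OF P(1)]] .
  have P_sum: "P (\<Sum>i\<in>I. f i) = (\<Sum>i\<in>I. P (f i))" for f :: "nat \<Rightarrow> 'a" and I
    by (rule linear_sum[OF bounded_linear.linear[OF bounded_clinear_imp_bounded_linear[OF P(1)]]])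
  have T_sum: "T (\<Sum>i\<in>I. f i) = (\<Sum>i\<in>I. T (f i))" for f :: "nat \<Rightarrow> 'a" and I
    by (rule linear_sum[OF bounded_linear.linear[OF bounded_clinear_imp_bounded_linear[OF T]]])

  have quad: "Re (cinner x (P (r n x))) = Re (cinner x (P x)) - (\<Sum>i<n. (cmod (cinner x (P (z i))))\<^sup>2)" for n x
  proof -
    have "cinner x (P (r n x)) = cinner x (P x) - (\<Sum>i<n. cinner (P (z i)) x * cinner x (P (z i)))"
      by (simp add: r_eq P_diff P_sum bounded_clinear_scaleC[OF P(1)] cinner_diff_right
          cinner_sum_right cinner_scaleC_right)
    also have "(\<Sum>i<n. cinner (P (z i)) x * cinner x (P (z i))) = (\<Sum>i<n. of_real ((cmod (cinner x (P (z i))))\<^sup>2))"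
      by (rule sum.cong) (simp, metis cinner_commute complex_norm_square mult.commute)
    finally show ?thesis by simp
  qed

  \<comment> \<open>By Parseval this is a double sum of squared matrix entries. Summed over
    \<open>i\<close> first, it contributes at most \<open>h j\<close> for each \<open>j\<close>,
    because the diagonal of the residual is nonnegative.\<close>
  have norm_w: "(\<Sum>i<n. (norm (P (z i)))\<^sup>2) \<le> suminf h" for n
  proof -
    have "(\<Sum>i<n. (norm (P (z i)))\<^sup>2) = (\<Sum>i<n. \<Sum>j. (cmod (cinner (e j) (P (z i))))\<^sup>2)"
      by (intro sum.cong refl sums_unique range_Parseval)
    also have "\<dots> = (\<Sum>j. \<Sum>i<n. (cmod (cinner (e j) (P (z i))))\<^sup>2)"
      by (rule suminf_sum[symmetric]) (rule sums_summable[OF range_Parseval])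
    also have "\<dots> \<le> suminf h"
    proof (rule suminf_le)
      show "(\<Sum>i<n. (cmod (cinner (e j) (P (z i))))\<^sup>2) \<le> h j" for j
        using quad[of "e j" n] pos_op_nonneg[OF A, of "e j" n] by (simp add: h_def)
      show "summable (\<lambda>j. \<Sum>i<n. (cmod (cinner (e j) (P (z i))))\<^sup>2)"
        by (rule summable_sum) (rule sums_summable[OF range_Parseval])
    qed (rule h)
    finally show ?thesis .
  qed

  \<comment> \<open>The entries of \<open>P (r n x)\<close> along \<open>e j\<close> vanish for
    \<open>j < n\<close>. For the others Cauchy-Schwarz bounds the square by \<open>h j\<close>
    times the form of \<open>P\<close> at \<open>x\<close>, as the residual forms never exceed that
    of \<open>P\<close>. What remains is a tail of the trace.\<close>
  have lim: "(\<lambda>n. P (r n x)) \<longlonglongrightarrow> 0" for x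
  proof -
    have bound: "(norm (P (r n x)))\<^sup>2 \<le> Re (cinner x (P x)) * (suminf h - (\<Sum>j<n. h j))" for n
    proof -
      define g where "g j = (if j < n then 0 else h j)" for j
      have gh: "g = (\<lambda>j. h j - (if j \<in> {..<n} then h j else 0))" by (auto simp: g_def)
      have g: "g sums (suminf h - (\<Sum>j<n. h j))"
        unfolding gh by (intro sums_diff summable_sums[OF h] sums_If_finite_set) simp
      have "(cmod (cinner (e j) (P (r n x))))\<^sup>2 \<le> Re (cinner x (P x)) * g j" for j
      proof (cases "j < n")
        case True
        have "cinner (e j) (P (r n x)) = 0"
          unfolding pos_op_selfadjoint[OF A, symmetric] A0[OF True] by simp
        then show ?thesis using True by (simp add: g_def)
      next
        case False
        have le: "Re (cinner y (P (r n y))) \<le> Re (cinner y (P y))" for y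
          unfolding quad by (simp add: sum_nonneg)
        have "(cmod (cinner (e j) (P (r n x))))\<^sup>2
            \<le> Re (cinner (e j) (P (r n (e j)))) * Re (cinner x (P (r n x)))"
          by (rule pos_op_Cauchy_Schwarz[OF A])
        also have "\<dots> \<le> h j * Re (cinner x (P x))"
          unfolding h_def by (intro mult_mono le pos_op_nonneg[OF A] pos_op_nonneg[OF pos])
        finally show ?thesis using False by (simp add: g_def mult.commute)
      qed
      then show ?thesis
        by (rule sums_le[OF _ range_Parseval sums_mult[OF g]])
    qed
    have "(\<lambda>n. Re (cinner x (P x)) * (suminf h - (\<Sum>j<n. h j)))
        \<longlonglongrightarrow> Re (cinner x (P x)) * (suminf h - suminf h)"
      by (intro tendsto_intros summable_LIMSEQ h)
    then have upper: "(\<lambda>n. Re (cinner x (P x)) * (suminf h - (\<Sum>j<n. h j))) \<longlonglongrightarrow> 0"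
      by simp
    have "(\<lambda>n. (norm (P (r n x)))\<^sup>2) \<longlonglongrightarrow> 0"
      by (rule real_tendsto_sandwich[OF _ _ tendsto_const upper]) (simp_all add: bound)
    then have "(\<lambda>n. sqrt ((norm (P (r n x)))\<^sup>2)) \<longlonglongrightarrow> sqrt 0" by (rule tendsto_real_sqrt)
    then have "(\<lambda>n. norm (P (r n x))) \<longlonglongrightarrow> 0" by simp
    then show ?thesis by (rule tendsto_norm_zero_cancel)
  qed

  show thesis
  proof (rule that[of "\<lambda>k. T (z k)" "\<lambda>k. P (z k)"])
    show "norm (T (z k)) = norm (P (z k))" for k by (rule norm_T)
    show "summable (\<lambda>k. (norm (P (z k)))\<^sup>2)"
      by (rule summableI_nonneg_bounded[OF _ norm_w]) simp
    show "(\<lambda>k. cinner (P (z k)) x *\<^sub>C T (z k)) sums T x" for x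
    proof -
      have "T x - (\<Sum>k<n. cinner (P (z k)) x *\<^sub>C T (z k)) = T (r n x)" for n
        by (simp add: r_eq T_diff T_sum bounded_clinear_scaleC[OF T])
      then have "norm (T x - (\<Sum>k<n. cinner (P (z k)) x *\<^sub>C T (z k))) = norm (P (r n x))" for n
        by (simp only: norm_T)
      moreover have "(\<lambda>n. norm (P (r n x))) \<longlonglongrightarrow> 0"
        using lim[of x] by (rule tendsto_norm_zero)
      ultimately have "(\<lambda>n. norm (T x - (\<Sum>k<n. cinner (P (z k)) x *\<^sub>C T (z k)))) \<longlonglongrightarrow> 0"
        by (simp only:)
      then have "(\<lambda>n. T x - (\<Sum>k<n. cinner (P (z k)) x *\<^sub>C T (z k))) \<longlonglongrightarrow> 0"
        by (rule tendsto_norm_zero_cancel)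
      then have "(\<lambda>n. T x - (T x - (\<Sum>k<n. cinner (P (z k)) x *\<^sub>C T (z k)))) \<longlonglongrightarrow> T x - 0"
        by (intro tendsto_intros)
      then show ?thesis by (simp add: sums_def)
    qed
  qed
qed

section \<open>Representations of C*-algebras\<close>

lemma norm_star [simp]: "norm (star a) = norm (a::'a::unital_cstar_algebra)"
proof -
  have "norm a \<le> norm (star a)" for a :: 'a
  proof (cases "a = 0")
    case False
    have "norm a * norm a \<le> norm (star a) * norm a"
      using cstar_identity[of a] norm_mult_ineq[of "star a" a] by (simp add: power2_eq_square)
    then show ?thesis using False by simp
  qed simp
  from this[of a] this[of "star a"] show ?thesis by (simp add: star_star)
qed

lemma is_adjoint_norm_le:
  assumes "is_adjoint S T" and S: "\<And>x. norm (S x) \<le> M * norm x"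
  shows "norm (T y) \<le> \<bar>M\<bar> * norm y"
proof (cases "T y = 0")
  case False
  have "(norm (T y))\<^sup>2 = Re (cinner y (S (T y)))"
    using assms(1) by (simp add: is_adjoint_def flip: cinner_self_eq_norm)
  also have "\<dots> \<le> norm y * norm (S (T y))"
    using complex_Re_le_cmod cinner_Cauchy_Schwarz by (rule order_trans)
  also have "\<dots> \<le> norm y * (\<bar>M\<bar> * norm (T y))"
    by (intro mult_left_mono order_trans[OF S] mult_right_mono) simp_all
  finally have "norm (T y) * norm (T y) \<le> (\<bar>M\<bar> * norm y) * norm (T y)"
    by (simp add: power2_eq_square mult_ac)
  then show ?thesis using False by simp
qed simp

context
  fixes \<pi> :: "'a::unital_cstar_algebra \<Rightarrow> 'h::chilbert_space \<Rightarrow> 'h"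
  assumes rep: "is_representation \<pi>"
begin

lemma rep_bounded_clinear: "bounded_clinear (\<pi> a)"
  using rep by (simp add: is_representation_def)

lemma rep_bounded_linear: "bounded_linear (\<pi> a)"
  by (rule bounded_clinear_imp_bounded_linear[OF rep_bounded_clinear])

lemma rep_one: "\<pi> 1 x = x"
  using rep by (simp add: is_representation_def)

lemma rep_add: "\<pi> (a + b) x = \<pi> a x + \<pi> b x"
  using rep by (simp add: is_representation_def)

lemma rep_scaleC: "\<pi> (c *\<^sub>C a) x = c *\<^sub>C \<pi> a x"
  using rep by (simp add: is_representation_def)

lemma rep_mult: "\<pi> (a * b) x = \<pi> a (\<pi> b x)"
  using rep by (simp add: is_representation_def)

lemma rep_star: "cinner (\<pi> (star a) x) y = cinner x (\<pi> a y)"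
  using rep by (auto simp: is_representation_def is_adjoint_def)

lemma rep_diff: "\<pi> (a - b) x = \<pi> a x - \<pi> b x"
  using rep_add[of "a - b" b x] by simp

text \<open>If \<open>M = onorm (\<pi> a) > norm a\<close>, then \<open>1 - star a * a / M\<^sup>2\<close> is invertible by the Neumann
  series, so that \<open>\<pi> a\<close> cannot nearly attain its norm \<open>M\<close>.\<close>

lemma rep_contractive: "norm (\<pi> a x) \<le> norm a * norm x"
proof -
  define M where "M = onorm (\<pi> a)"
  have M: "norm (\<pi> a x) \<le> M * norm x" for x
    unfolding M_def by (rule onorm[OF rep_bounded_linear])
  have M0: "0 \<le> M" unfolding M_def by (rule onorm_pos_le[OF rep_bounded_linear])
  have M_star: "norm (\<pi> (star a) y) \<le> M * norm y" for y
    using is_adjoint_norm_le[of "\<pi> a" "\<pi> (star a)" M y] M M0 by (simp add: is_adjoint_def rep_star)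
  have "M \<le> norm a"
  proof (rule ccontr)
    assume "\<not> M \<le> norm a"
    then have Ma: "norm a < M" and Mpos: "0 < M" using norm_ge_zero[of a] by linarith+
    define h where "h = of_real (1 / M\<^sup>2) *\<^sub>C (star a * a)"
    have "norm h = (norm a / M)\<^sup>2"
      using Mpos by (simp add: h_def norm_scaleC cstar_identity power_divide norm_divide norm_power)
    also have "\<dots> < 1"
      using Ma Mpos by (simp add: power_less_one_iff abs_square_less_1)
    finally have h: "norm h < 1" .
    define s where "s = (\<Sum>n. h ^ n)"
    have sums: "(\<lambda>n. h ^ n) sums s"
      unfolding s_def by (rule summable_sums[OF complete_algebra_summable_geometric[OF h]])
    have "s * h = s - 1"
    proof (rule sums_unique2)
      show "(\<lambda>n. h ^ n * h) sums (s * h)" by (rule sums_mult2[OF sums])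
      show "(\<lambda>n. h ^ n * h) sums (s - 1)"
        using sums_Suc_iff[of "\<lambda>n. h ^ n" "s - 1"] sums by (simp add: power_commutes)
    qed
    then have "s * (1 - h) = 1" by (simp add: right_diff_distrib)
    then have inv: "\<pi> s (x - \<pi> h x) = x" for x
      using rep_mult[of s "1 - h" x] by (simp add: rep_one rep_diff)
    \<comment> \<open>The added 1 ensures \<open>1 \<le> K\<close>, so that
      \<open>1 - 1 / K\<^sup>2\<close> lies in [0,1) whatever the norm of
      \<open>\<pi> s\<close>.\<close>
    define K where "K = onorm (\<pi> s) + 1"
    have K1: "1 \<le> K" unfolding K_def using onorm_pos_le[OF rep_bounded_linear] by simp
    have K: "norm (\<pi> s x) \<le> K * norm x" for x
      using onorm[OF rep_bounded_linear, of s x] by (simp add: K_def distrib_right add_increasing2)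
    \<comment> \<open>Since \<open>norm (\<pi> h x) \<le> norm (\<pi> a x) / M\<close>, the
      quadratic term of the expansion cancels at most half of the cross term.\<close>
    have h_sq: "(norm (x - \<pi> h x))\<^sup>2 \<le> (norm x)\<^sup>2 - (norm (\<pi> a x))\<^sup>2 / M\<^sup>2" for x
    proof -
      have \<pi>h: "\<pi> h x = of_real (1 / M\<^sup>2) *\<^sub>C \<pi> (star a) (\<pi> a x)"
        by (simp add: h_def rep_scaleC rep_mult)
      have "cinner x (\<pi> h x) = of_real (1 / M\<^sup>2) * cinner (\<pi> a x) (\<pi> a x)"
        unfolding \<pi>h cinner_scaleC_right by (metis rep_star star_star)
      then have 1: "Re (cinner x (\<pi> h x)) = (norm (\<pi> a x))\<^sup>2 / M\<^sup>2"
        by (simp add: cinner_self flip: of_real_power of_real_divide of_real_mult)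
      have "norm (\<pi> h x) = norm (\<pi> (star a) (\<pi> a x)) / M\<^sup>2"
        unfolding \<pi>h norm_scaleC norm_of_real by simp
      also have "\<dots> \<le> M * norm (\<pi> a x) / M\<^sup>2"
        by (intro divide_right_mono M_star) simp
      also have "\<dots> = norm (\<pi> a x) / M" using Mpos by (simp add: power2_eq_square)
      finally have "(norm (\<pi> h x))\<^sup>2 \<le> (norm (\<pi> a x) / M)\<^sup>2" by (rule power_mono) simp
      then show ?thesis unfolding norm_diff_sq 1 by (simp add: power_divide)
    qed
    define q where "q = M * sqrt (1 - 1 / K\<^sup>2)"
    have qM: "q < M"
    proof -
      have "sqrt (1 - 1 / K\<^sup>2) < sqrt 1" using K1 by (subst real_sqrt_less_iff) simp
      then show ?thesis unfolding q_def using Mpos by simp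
    qed
    have "norm (\<pi> a x) \<le> q * norm x" for x
    proof (rule power2_le_imp_le)
      have "norm x \<le> K * norm (x - \<pi> h x)" using K[of "x - \<pi> h x"] by (simp add: inv)
      then have "(norm x)\<^sup>2 \<le> K\<^sup>2 * (norm (x - \<pi> h x))\<^sup>2"
        by (metis norm_ge_zero power_mono power_mult_distrib)
      also have "\<dots> \<le> K\<^sup>2 * ((norm x)\<^sup>2 - (norm (\<pi> a x))\<^sup>2 / M\<^sup>2)"
        by (intro mult_left_mono h_sq) simp
      finally have *: "(norm (\<pi> a x))\<^sup>2 \<le> M\<^sup>2 * (1 - 1 / K\<^sup>2) * (norm x)\<^sup>2"
        using K1 Mpos by (simp add: field_simps)
      have "0 \<le> 1 - 1 / K\<^sup>2" using K1 by simp
      then show "(norm (\<pi> a x))\<^sup>2 \<le> (q * norm x)\<^sup>2"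
        using * by (simp add: q_def power_mult_distrib)
      show "0 \<le> q * norm x" unfolding q_def using M0 K1 by simp
    qed
    moreover have "0 \<le> q" unfolding q_def using M0 K1 by simp
    ultimately have "onorm (\<pi> a) \<le> q" by (intro onorm_bound)
    then have "M \<le> q" by (simp add: M_def)
    then show False using qM by simp
  qed
  then show ?thesis using M[of x] by (meson mult_right_mono norm_ge_zero order_trans)
qed

end

section \<open>Functionals that are series of vector functionals\<close>

text \<open>The bound \<open>C\<close> controls the trace norm of a trace-class operator representing \<open>\<omega>\<close>.\<close>

definition vector_series ::
    "('a::unital_cstar_algebra \<Rightarrow> 'h::chilbert_space \<Rightarrow> 'h) \<Rightarrow> real \<Rightarrow> ('a \<Rightarrow> complex) \<Rightarrow> bool" where
  "vector_series \<pi> C \<omega> \<longleftrightarrow> (\<exists>\<xi> \<eta> :: nat \<Rightarrow> 'h. summable (\<lambda>n. norm (\<xi> n) * norm (\<eta> n)) \<and>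
     (\<Sum>n. norm (\<xi> n) * norm (\<eta> n)) \<le> C \<and> (\<forall>a. (\<lambda>n. cinner (\<xi> n) (\<pi> a (\<eta> n))) sums \<omega> a))"

lemma vector_series_mono: "vector_series \<pi> C \<omega> \<Longrightarrow> C \<le> D \<Longrightarrow> vector_series \<pi> D \<omega>"
  unfolding vector_series_def by (meson order_trans)

context
  fixes \<pi> :: "'a::unital_cstar_algebra \<Rightarrow> 'h::chilbert_space \<Rightarrow> 'h"
  assumes rep: "is_representation \<pi>"
begin

lemma vector_series_nonneg: "vector_series \<pi> C \<omega> \<Longrightarrow> 0 \<le> C"
  unfolding vector_series_def
  by (elim exE conjE, rule order_trans[OF suminf_nonneg]) auto

lemma cmod_cinner_rep_le: "cmod (cinner x (\<pi> a y)) \<le> norm a * (norm x * norm y)"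
proof -
  have "cmod (cinner x (\<pi> a y)) \<le> norm x * norm (\<pi> a y)" by (rule cinner_Cauchy_Schwarz)
  also have "\<dots> \<le> norm x * (norm a * norm y)"
    by (intro mult_left_mono rep_contractive[OF rep]) simp
  finally show ?thesis by (simp add: mult_ac)
qed

lemma vector_series_bound:
  assumes "vector_series \<pi> C \<omega>" shows "cmod (\<omega> a) \<le> C * norm a"
proof -
  obtain \<xi> \<eta> :: "nat \<Rightarrow> 'h" where s: "summable (\<lambda>n. norm (\<xi> n) * norm (\<eta> n))"
    "(\<Sum>n. norm (\<xi> n) * norm (\<eta> n)) \<le> C" "(\<lambda>n. cinner (\<xi> n) (\<pi> a (\<eta> n))) sums \<omega> a"
    using assms by (auto simp: vector_series_def)
  have "cmod (\<omega> a) \<le> (\<Sum>n. norm a * (norm (\<xi> n) * norm (\<eta> n)))"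
    unfolding sums_unique[OF s(3)]
    by (rule norm_suminf_le[OF cmod_cinner_rep_le summable_mult[OF s(1)]])
  also have "\<dots> = norm a * (\<Sum>n. norm (\<xi> n) * norm (\<eta> n))"
    by (rule suminf_mult[OF s(1)])
  also have "\<dots> \<le> norm a * C" by (intro mult_left_mono s) simp
  finally show ?thesis by (simp add: mult.commute)
qed

lemma vector_series_bounded_clinear:
  assumes "vector_series \<pi> C \<omega>" shows "bounded_clinear \<omega>"
proof -
  obtain \<xi> \<eta> :: "nat \<Rightarrow> 'h" where s: "\<And>a. (\<lambda>n. cinner (\<xi> n) (\<pi> a (\<eta> n))) sums \<omega> a"
    using assms by (auto simp: vector_series_def)
  have "\<omega> (a + b) = \<omega> a + \<omega> b" for a b
    using sums_unique2[OF s] sums_add[OF s[of a] s[of b]]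
    by (simp add: rep_add[OF rep] cinner_add_right)
  moreover have "\<omega> (c *\<^sub>C a) = c *\<^sub>C \<omega> a" for c a
    using sums_unique2[OF s] sums_mult[OF s[of a], of c]
    by (simp add: rep_scaleC[OF rep] cinner_scaleC_right scaleC_complex_def)
  ultimately show ?thesis
    unfolding bounded_clinear_def clinear_on_def bounded_on_def
    using vector_series_bound[OF assms] by auto
qed

lemma vector_series_single: "vector_series \<pi> (norm x * norm y) (\<lambda>a. cinner x (\<pi> a y))"
  unfolding vector_series_def
proof (intro exI conjI allI)
  let ?\<xi> = "\<lambda>n::nat. if n = 0 then x else 0" and ?\<eta> = "\<lambda>n::nat. if n = 0 then y else 0"
  have *: "(\<lambda>n. norm (?\<xi> n) * norm (?\<eta> n)) sums (\<Sum>n\<in>{0}. norm (?\<xi> n) * norm (?\<eta> n))"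
    by (rule sums_finite) auto
  show "summable (\<lambda>n. norm (?\<xi> n) * norm (?\<eta> n))" using * by (rule sums_summable)
  show "(\<Sum>n. norm (?\<xi> n) * norm (?\<eta> n)) \<le> norm x * norm y" using sums_unique[OF *] by simp
  have "(\<lambda>n. cinner (?\<xi> n) (\<pi> a (?\<eta> n))) sums (\<Sum>n\<in>{0}. cinner (?\<xi> n) (\<pi> a (?\<eta> n)))" for a
    by (rule sums_finite) auto
  then show "(\<lambda>n. cinner (?\<xi> n) (\<pi> a (?\<eta> n))) sums cinner x (\<pi> a y)" for a by simp
qed

text \<open>Covers multiplication by fixed elements on either side and by scalars: a map of the
  algebra is traded for maps of the vectors.\<close>

lemma vector_series_map:
  assumes "vector_series \<pi> C \<omega>"
    and f: "\<And>x. norm (f x) \<le> B * norm x" and g: "\<And>x. norm (g x) \<le> D * norm x"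
    and eq: "\<And>x y a. cinner x (\<pi> (T a) y) = cinner (f x) (\<pi> a (g y))"
    and BD: "0 \<le> B" "0 \<le> D"
  shows "vector_series \<pi> (B * D * C) (\<lambda>a. \<omega> (T a))"
proof -
  obtain \<xi> \<eta> :: "nat \<Rightarrow> 'h" where s: "summable (\<lambda>n. norm (\<xi> n) * norm (\<eta> n))"
    "(\<Sum>n. norm (\<xi> n) * norm (\<eta> n)) \<le> C" "\<And>a. (\<lambda>n. cinner (\<xi> n) (\<pi> a (\<eta> n))) sums \<omega> a"
    using assms(1) by (auto simp: vector_series_def)
  have le: "norm (f (\<xi> n)) * norm (g (\<eta> n)) \<le> B * D * (norm (\<xi> n) * norm (\<eta> n))" for n
    using mult_mono[OF f[of "\<xi> n"] g[of "\<eta> n"]] BD by (simp add: mult_ac)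
  have sum: "summable (\<lambda>n. norm (f (\<xi> n)) * norm (g (\<eta> n)))"
    by (rule summable_comparison_test'[OF summable_mult[OF s(1)]]) (use le in simp)
  have "(\<Sum>n. norm (f (\<xi> n)) * norm (g (\<eta> n))) \<le> (\<Sum>n. B * D * (norm (\<xi> n) * norm (\<eta> n)))"
    by (rule suminf_le[OF le sum summable_mult[OF s(1)]])
  also have "\<dots> = B * D * (\<Sum>n. norm (\<xi> n) * norm (\<eta> n))" by (rule suminf_mult[OF s(1)])
  also have "\<dots> \<le> B * D * C" using s(2) BD by (simp add: mult_left_mono)
  finally show ?thesis
    unfolding vector_series_def using sum s(3)
    by (intro exI[of _ "\<lambda>n. f (\<xi> n)"] exI[of _ "\<lambda>n. g (\<eta> n)"]) (simp flip: eq)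
qed

lemma vector_series_mult_left:
  assumes "vector_series \<pi> C \<omega>" shows "vector_series \<pi> (norm b * C) (\<lambda>a. \<omega> (b * a))"
  using vector_series_map[OF assms, of "\<pi> (star b)" "norm b" "\<lambda>x. x" 1 "\<lambda>a. b * a"]
    rep_contractive[OF rep, of "star b"]
  by (simp add: rep_star[OF rep] rep_mult[OF rep])

lemma vector_series_mult_right:
  assumes "vector_series \<pi> C \<omega>" shows "vector_series \<pi> (norm b * C) (\<lambda>a. \<omega> (a * b))"
  using vector_series_map[OF assms, of "\<lambda>x. x" 1 "\<pi> b" "norm b" "\<lambda>a. a * b"]
    rep_contractive[OF rep, of b]
  by (simp add: rep_mult[OF rep])

lemma vector_series_scaleR:
  assumes "vector_series \<pi> C \<omega>" shows "vector_series \<pi> (\<bar>r\<bar> * C) (\<lambda>a. r *\<^sub>R \<omega> a)"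
proof -
  have "r *\<^sub>R \<omega> a = \<omega> (r *\<^sub>R a)" for a
    by (simp add: bounded_clinear_scaleR[OF vector_series_bounded_clinear[OF assms]])
  moreover have "\<pi> (r *\<^sub>R a) x = r *\<^sub>R \<pi> a x" for a x
    by (simp add: rep_scaleC[OF rep] flip: scaleC_of_real)
  ultimately show ?thesis
    using vector_series_map[OF assms, of "\<lambda>x. x" 1 "\<lambda>x. r *\<^sub>R x" "\<bar>r\<bar>" "\<lambda>a. r *\<^sub>R a"]
    by (simp add: bounded_clinear_scaleR[OF rep_bounded_clinear[OF rep]])
qed

text \<open>A double series, enumerated along \<open>prod_decode\<close>. The rearrangement is
  legitimate because the products of norms, summed over \<open>n\<close> first, are bounded by the
  summable \<open>C\<close>, and the terms at \<open>a\<close> are dominated by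
  \<open>norm a\<close> times these products.\<close>

lemma vector_series_suminf:
  assumes \<omega>: "\<And>k::nat. vector_series \<pi> (C k) (\<omega> k)" and C: "summable C"
    and sums: "\<And>a. (\<lambda>k. \<omega> k a) sums \<phi> a"
  shows "vector_series \<pi> (suminf C) \<phi>"
proof -
  have "\<forall>k. \<exists>\<xi>. \<exists>\<eta> :: nat \<Rightarrow> 'h. summable (\<lambda>n. norm (\<xi> n) * norm (\<eta> n)) \<and>
     (\<Sum>n. norm (\<xi> n) * norm (\<eta> n)) \<le> C k \<and> (\<forall>a. (\<lambda>n. cinner (\<xi> n) (\<pi> a (\<eta> n))) sums \<omega> k a)"
    using \<omega> unfolding vector_series_def by blast
  from choice[OF this] obtain \<xi> where
    "\<forall>k. \<exists>\<eta> :: nat \<Rightarrow> 'h. summable (\<lambda>n. norm (\<xi> k n) * norm (\<eta> n)) \<and>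
     (\<Sum>n. norm (\<xi> k n) * norm (\<eta> n)) \<le> C k \<and> (\<forall>a. (\<lambda>n. cinner (\<xi> k n) (\<pi> a (\<eta> n))) sums \<omega> k a)"
    by (rule exE)
  from choice[OF this] obtain \<eta> where s: "\<And>k. summable (\<lambda>n. norm (\<xi> k n) * norm (\<eta> k n))"
    "\<And>k. (\<Sum>n. norm (\<xi> k n) * norm (\<eta> k n)) \<le> C k"
    "\<And>k a. (\<lambda>n. cinner (\<xi> k n) (\<pi> a (\<eta> k n))) sums \<omega> k a"
    by blast
  define N where "N = (\<lambda>(k, n). norm (\<xi> k n) * norm (\<eta> k n))"
  define g where "g k = (\<Sum>n. norm (\<xi> k n) * norm (\<eta> k n))" for k
  have g0: "0 \<le> g k" for k unfolding g_def by (intro suminf_nonneg s(1)) simp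
  have gsum: "summable g"
  proof (rule summable_comparison_test'[OF C, where N=0])
    show "norm (g k) \<le> C k" for k using s(2)[of k] g0[of k] by (simp add: g_def)
  qed
  have N1: "((\<lambda>n. N (k, n)) has_sum g k) UNIV" for k
    unfolding N_def g_def using s(1)[of k]
    by (simp, intro norm_summable_imp_has_sum) (simp_all add: summable_sums)
  have N2: "(g has_sum suminf g) UNIV"
    using gsum g0 by (intro norm_summable_imp_has_sum) (simp_all add: summable_sums)
  have N3: "N summable_on (UNIV \<times> UNIV)"
    by (rule summable_on_SigmaI[OF N1]) (use N2 in \<open>auto simp: summable_on_def N_def\<close>)
  have N4: "(N has_sum suminf g) UNIV"
    using has_sum_SigmaI[OF N1 N2 N3] by simp
  have N5: "((\<lambda>m. N (prod_decode m)) has_sum suminf g) UNIV"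
    using N4 by (subst has_sum_reindex_bij_betw[OF bij_prod_decode])
  have A: "((\<lambda>m. case prod_decode m of (k, n) \<Rightarrow> cinner (\<xi> k n) (\<pi> a (\<eta> k n))) sums \<phi> a)" for a
  proof -
    define f where "f = (\<lambda>(k, n). cinner (\<xi> k n) (\<pi> a (\<eta> k n)))"
    have fN: "norm (f p) \<le> norm a * N p" for p
      unfolding f_def N_def by (cases p) (simp add: cmod_cinner_rep_le)
    have f1: "((\<lambda>n. f (k, n)) has_sum \<omega> k a) UNIV" for k
    proof (rule norm_summable_imp_has_sum)
      show "summable (\<lambda>n. norm (f (k, n)))"
        by (rule summable_comparison_test'[OF summable_mult[OF s(1)[of k], of "norm a"]])
           (use fN[of "(k, _)"] in \<open>simp add: N_def\<close>)
      show "(\<lambda>n. f (k, n)) sums \<omega> k a" using s(3) by (simp add: f_def)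
    qed
    have f2: "((\<lambda>k. \<omega> k a) has_sum \<phi> a) UNIV"
    proof (rule norm_summable_imp_has_sum[OF _ sums])
      show "summable (\<lambda>k. norm (\<omega> k a))"
        by (rule summable_comparison_test'[OF summable_mult2[OF C, of "norm a"]])
           (use vector_series_bound[OF \<omega>] in simp)
    qed
    have f3: "f summable_on (UNIV \<times> UNIV)"
    proof (rule abs_summable_summable, rule summable_on_comparison_test)
      show "(\<lambda>p. norm a * N p) summable_on (UNIV \<times> UNIV)"
        by (rule summable_on_cmult_right[OF N3])
    qed (use fN in auto)
    have "(f has_sum \<phi> a) UNIV" using has_sum_SigmaI[OF f1 f2 f3] by simp
    then have "((\<lambda>m. f (prod_decode m)) has_sum \<phi> a) UNIV"
      by (subst has_sum_reindex_bij_betw[OF bij_prod_decode])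
    then show ?thesis unfolding f_def by (rule has_sum_imp_sums)
  qed
  have "suminf g \<le> suminf C"
    by (rule suminf_le[OF _ gsum C]) (simp add: g_def s(2))
  then show ?thesis
    unfolding vector_series_def
    using A has_sum_imp_sums[OF N5]
    by (intro exI[of _ "\<lambda>m. case_prod \<xi> (prod_decode m)"] exI[of _ "\<lambda>m. case_prod \<eta> (prod_decode m)"])
       (auto simp: N_def case_prod_beta sums_iff)
qed

lemma vector_series_zero: "vector_series \<pi> 0 (\<lambda>a. 0)"
  using vector_series_single[of 0 0] by simp

lemma vector_series_add:
  assumes "vector_series \<pi> C \<omega>" "vector_series \<pi> D \<phi>"
  shows "vector_series \<pi> (C + D) (\<lambda>a. \<omega> a + \<phi> a)"
proof -
  define X where "X k = (if k = 0 then C else if k = 1 then D else 0)" for k :: nat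
  define \<psi> where "\<psi> k a = (if k = 0 then \<omega> a else if k = 1 then \<phi> a else 0)" for k :: nat and a
  have X: "X sums (\<Sum>k\<in>{0,1}. X k)" by (rule sums_finite) (auto simp: X_def)
  have *: "(\<lambda>k. \<psi> k a) sums (\<Sum>k\<in>{0,1}. \<psi> k a)" for a by (rule sums_finite) (auto simp: \<psi>_def)
  have "vector_series \<pi> (suminf X) (\<lambda>a. \<Sum>k\<in>{0,1}. \<psi> k a)"
  proof (rule vector_series_suminf[OF _ sums_summable[OF X] *])
    show "vector_series \<pi> (X k) (\<psi> k)" for k
      using assms vector_series_zero by (simp add: X_def \<psi>_def[abs_def])
  qed
  then show ?thesis unfolding sums_unique[OF X, symmetric] by (simp add: X_def \<psi>_def)
qed

text \<open>The series makes sense for every bounded operator, and with square summable vectors it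
  is one of the functionals that generate the ultraweak topology, so its continuity is
  immediate.\<close>

lemma vector_series_normal:
  assumes "vector_series \<pi> C \<omega>"
  shows "normal_in_rep \<pi> \<omega>"
proof -
  obtain \<xi> \<eta> :: "nat \<Rightarrow> 'h" where s: "summable (\<lambda>n. norm (\<xi> n) * norm (\<eta> n))"
    "\<And>a. (\<lambda>n. cinner (\<xi> n) (\<pi> a (\<eta> n))) sums \<omega> a"
    using assms by (auto simp: vector_series_def)
  \<comment> \<open>Balancing the two vectors makes both sequences square summable.\<close>
  define b where "b n = sqrt (norm (\<eta> n) / norm (\<xi> n))" for n
  define c where "c n = sqrt (norm (\<xi> n) / norm (\<eta> n))" for n
  \<comment> \<open>If either vector is zero, division by zero makes \<open>b n\<close> and
    \<open>c n\<close> zero, and both sides of \<open>eq\<close> below vanish.\<close>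
  have bc: "b n *\<^sub>R \<xi> n = 0 \<and> \<xi> n = 0 \<or> \<eta> n = 0 \<or> b n * c n = 1" for n
    by (auto simp: b_def c_def simp flip: real_sqrt_mult)
  have sq: "(sqrt (q / p) * p)\<^sup>2 \<le> p * q" if "0 \<le> p" "0 \<le> q" for p q :: real
    using that by (cases "p = 0") (simp_all add: power_mult_distrib power2_eq_square[of p])
  have norm_b: "(norm (b n *\<^sub>R \<xi> n))\<^sup>2 \<le> norm (\<xi> n) * norm (\<eta> n)" for n
    using sq[of "norm (\<xi> n)" "norm (\<eta> n)"] by (simp add: b_def)
  have norm_c: "(norm (c n *\<^sub>R \<eta> n))\<^sup>2 \<le> norm (\<xi> n) * norm (\<eta> n)" for n
    using sq[of "norm (\<eta> n)" "norm (\<xi> n)"] by (simp add: c_def mult.commute)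
  have sq_b: "summable (\<lambda>n. (norm (b n *\<^sub>R \<xi> n))\<^sup>2)"
    by (rule summable_comparison_test'[OF s(1)]) (use norm_b in simp)
  have sq_c: "summable (\<lambda>n. (norm (c n *\<^sub>R \<eta> n))\<^sup>2)"
    by (rule summable_comparison_test'[OF s(1)]) (use norm_c in simp)
  define \<psi> where "\<psi> A = (\<Sum>n. cinner (b n *\<^sub>R \<xi> n) (A (c n *\<^sub>R \<eta> n)))" for A
  define M where "M = commutant (commutant (range \<pi>))"
  have M: "bounded_clinear A" if "A \<in> M" for A using that by (simp add: M_def commutant_def)
  have eq: "cinner (b n *\<^sub>R \<xi> n) (A (c n *\<^sub>R \<eta> n)) = cinner (\<xi> n) (A (\<eta> n))"
    if "bounded_clinear A" for A n
  proof -
    have "cinner (b n *\<^sub>R \<xi> n) (A (c n *\<^sub>R \<eta> n)) = of_real (b n * c n) * cinner (\<xi> n) (A (\<eta> n))"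
      by (simp add: bounded_clinear_scaleR[OF that] cinner_scaleR_left cinner_scaleR_right)
    moreover have "\<eta> n = 0 \<Longrightarrow> A (\<eta> n) = 0"
      using bounded_clinear_scaleC[OF that, of 0 0] by simp
    ultimately show ?thesis using bc[of n] by (auto simp del: of_real_mult)
  qed
  have summ: "summable (\<lambda>n. cinner (\<xi> n) (A (\<eta> n)))" if A: "bounded_clinear A" for A
  proof -
    obtain K where K: "\<And>x. norm (A x) \<le> norm x * K"
      using bounded_linear.bounded[OF bounded_clinear_imp_bounded_linear[OF A]] by blast
    have "norm (cinner (\<xi> n) (A (\<eta> n))) \<le> K * (norm (\<xi> n) * norm (\<eta> n))" for n
      using order_trans[OF cinner_Cauchy_Schwarz mult_left_mono[OF K norm_ge_zero], of "\<xi> n" "\<eta> n"]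
      by (simp only: mult_ac)
    then show ?thesis
      by (intro summable_comparison_test'[OF summable_mult[OF s(1), of K]])
  qed
  have \<psi>: "\<psi> A = (\<Sum>n. cinner (\<xi> n) (A (\<eta> n)))" if "A \<in> M" for A
    by (simp add: \<psi>_def eq[OF M[OF that]])
  have M_iff: "A \<in> M \<longleftrightarrow> bounded_clinear A \<and> (\<forall>D\<in>commutant (range \<pi>). \<forall>x. A (D x) = D (A x))" for A
    unfolding M_def commutant_def[of "commutant _"] by (simp add: fun_eq_iff)
  have commutant: "bounded_clinear D" if "D \<in> commutant (range \<pi>)" for D
    using that by (simp add: commutant_def)
  have addM: "(\<lambda>x. A x + B x) \<in> M" if "A \<in> M" "B \<in> M" for A B
  proof -
    have "bounded_clinear (\<lambda>x. A x + B x)"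
    proof (rule bounded_clinearI)
      show "bounded_linear (\<lambda>x. A x + B x)"
        by (intro bounded_linear_add bounded_clinear_imp_bounded_linear M that)
      show "A (w *\<^sub>C x) + B (w *\<^sub>C x) = w *\<^sub>C (A x + B x)" for w x
        by (simp add: bounded_clinear_scaleC[OF M] that scaleC_add_right)
    qed
    then show ?thesis using that unfolding M_iff by (auto simp: bounded_clinear_add[OF commutant])
  qed
  have scaleM: "(\<lambda>x. z *\<^sub>C A x) \<in> M" if "A \<in> M" for A z
  proof -
    have "bounded_clinear (\<lambda>x. z *\<^sub>C A x)"
    proof (rule bounded_clinearI)
      show "bounded_linear (\<lambda>x. z *\<^sub>C A x)"
        by (rule bounded_linear_compose[OF bounded_linear_scaleC_right
              bounded_clinear_imp_bounded_linear[OF M[OF that]]])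
      show "z *\<^sub>C A (w *\<^sub>C x) = w *\<^sub>C z *\<^sub>C A x" for w x
        by (simp add: bounded_clinear_scaleC[OF M[OF that]] scaleC_scaleC mult.commute[of z w])
    qed
    then show ?thesis using that unfolding M_iff by (auto simp: bounded_clinear_scaleC[OF commutant])
  qed
  have "normal_functional M \<psi>"
    unfolding normal_functional_def
  proof (intro conjI ballI allI)
    fix A B assume A: "A \<in> M" and B: "B \<in> M"
    show "\<psi> (\<lambda>x. A x + B x) = \<psi> A + \<psi> B"
      using suminf_add[OF summ[OF M[OF A]] summ[OF M[OF B]]]
      by (simp add: \<psi>[OF A] \<psi>[OF B] \<psi>[OF addM[OF A B]] cinner_add_right)
  next
    fix z A assume A: "A \<in> M"
    show "\<psi> (\<lambda>x. z *\<^sub>C A x) = z * \<psi> A"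
      using suminf_mult[OF summ[OF M[OF A]], of z]
      by (simp add: \<psi>[OF A] \<psi>[OF scaleM[OF A]] cinner_scaleC_right)
  next
    have "openin (subtopology ultraweak_topology M)
        {A \<in> topspace (subtopology ultraweak_topology M). \<psi> A \<in> U}" if U: "open U" for U
    proof -
      define W where "W = {A. bounded_clinear A \<and> \<psi> A \<in> U}"
      have "openin ultraweak_topology W"
        unfolding ultraweak_topology_def
      proof (rule topology_generated_by_Basis)
        show "W \<in> {{T. bounded_clinear T \<and> (\<Sum>n. cinner (\<xi> n) (T (\<eta> n))) \<in> U} | \<xi> \<eta> U.
            summable (\<lambda>n::nat. (norm (\<xi> n))\<^sup>2) \<and> summable (\<lambda>n. (norm (\<eta> n))\<^sup>2) \<and> open U}"
          unfolding W_def \<psi>_def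
          by (rule CollectI, rule exI[of _ "\<lambda>n. b n *\<^sub>R \<xi> n"],
              rule exI[of _ "\<lambda>n. c n *\<^sub>R \<eta> n"], rule exI[of _ U])
             (simp only: sq_b sq_c U simp_thms)
      qed
      then have "openin (subtopology ultraweak_topology M) (M \<inter> W)"
        by (rule openin_subtopology_Int2)
      moreover have "{A \<in> topspace (subtopology ultraweak_topology M). \<psi> A \<in> U} = M \<inter> W"
      proof (intro equalityI subsetI)
        show "A \<in> M \<inter> W" if "A \<in> {A \<in> topspace (subtopology ultraweak_topology M). \<psi> A \<in> U}" for A
          using that M by (simp add: W_def)
        show "A \<in> {A \<in> topspace (subtopology ultraweak_topology M). \<psi> A \<in> U}" if "A \<in> M \<inter> W" for A
          using that openin_subset[OF \<open>openin ultraweak_topology W\<close>] by (auto simp: W_def)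
      qed
      ultimately show ?thesis by simp
    qed
    then show "continuous_map (subtopology ultraweak_topology M) euclidean \<psi>"
      by (simp add: continuous_map_def)
  qed
  moreover have "\<omega> a = \<psi> (\<pi> a)" for a
    unfolding \<psi>_def eq[OF rep_bounded_clinear[OF rep]] by (rule sums_unique[OF s(2)])
  ultimately show ?thesis unfolding normal_in_rep_def M_def by blast
qed

end

section \<open>Contractions on the selfdual CAR algebra\<close>

lemma star_one [simp]: "star (1::'a::unital_cstar_algebra) = 1"
  by (metis mult_1 mult_1_right star_mult star_star)

lemma star_zero [simp]: "star (0::'a::unital_cstar_algebra) = 0"
  using star_add[of 0 "0::'a"] by simp

lemma subspace_closure:
  fixes V :: "'b::real_normed_vector set"
  assumes "subspace V" shows "subspace (closure V)"
proof (rule subspaceI)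
  show "0 \<in> closure V" using subspace_0[OF assms] closure_subset by blast
next
  fix x y assume "x \<in> closure V" "y \<in> closure V"
  then obtain f g where "\<And>n. f n \<in> V" "\<And>n. g n \<in> V" "f \<longlonglongrightarrow> x" "g \<longlonglongrightarrow> y"
    by (auto simp: closure_sequential)
  then show "x + y \<in> closure V"
    unfolding closure_sequential
    by (intro exI[of _ "\<lambda>n. f n + g n"]) (simp add: subspace_add[OF assms] tendsto_add)
next
  fix c x assume "x \<in> closure V"
  then obtain f where "\<And>n. f n \<in> V" "f \<longlonglongrightarrow> x" by (auto simp: closure_sequential)
  then show "c *\<^sub>R x \<in> closure V"
    unfolding closure_sequential
    by (intro exI[of _ "\<lambda>n. c *\<^sub>R f n"]) (simp add: subspace_scale[OF assms] tendsto_scaleR)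
qed

locale selfdual_CAR =
  fixes \<Gamma> :: "'k::chilbert_space \<Rightarrow> 'k" and F :: "'k \<Rightarrow> 'a::unital_cstar_algebra"
  assumes involution: "antiunitary_involution \<Gamma>"
    and F_clinear: "clinear_on UNIV F"
    and star_F: "star (F f) = F (\<Gamma> f)"
    and car: "star (F f) * F g + F g * star (F f) = cinner f g *\<^sub>C 1"
begin

lemma \<Gamma>_add: "\<Gamma> (x + y) = \<Gamma> x + \<Gamma> y"
  and \<Gamma>_scaleC: "\<Gamma> (c *\<^sub>C x) = cnj c *\<^sub>C \<Gamma> x"
  and cinner_\<Gamma>_\<Gamma>: "cinner (\<Gamma> x) (\<Gamma> y) = cinner y x"
  and \<Gamma>_\<Gamma> [simp]: "\<Gamma> (\<Gamma> x) = x"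
  using involution by (auto simp: antiunitary_involution_def)

lemma cinner_\<Gamma>_commute: "cinner (\<Gamma> x) y = cinner (\<Gamma> y) x"
  using cinner_\<Gamma>_\<Gamma>[of x "\<Gamma> y"] by simp

lemma norm_\<Gamma> [simp]: "norm (\<Gamma> x) = norm x"
proof -
  have "(norm (\<Gamma> x))\<^sup>2 = (norm x)\<^sup>2" by (simp only: cinner_\<Gamma>_\<Gamma> flip: cinner_self_eq_norm)
  then show ?thesis by simp
qed

lemma \<Gamma>_scaleR: "\<Gamma> (r *\<^sub>R x) = r *\<^sub>R \<Gamma> x"
  using \<Gamma>_scaleC[of "of_real r" x] by (simp add: scaleC_of_real)

lemma \<Gamma>_minus: "\<Gamma> (- x) = - \<Gamma> x"
  using \<Gamma>_scaleR[of "-1" x] by simp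

lemma \<Gamma>_diff: "\<Gamma> (x - y) = \<Gamma> x - \<Gamma> y"
  using \<Gamma>_add[of x "-y"] by (simp add: \<Gamma>_minus)

lemma F_add: "F (x + y) = F x + F y"
  and F_scaleC: "F (c *\<^sub>C x) = c *\<^sub>C F x"
  using F_clinear by (auto simp: clinear_on_def)

lemma F_scaleR: "F (r *\<^sub>R x) = r *\<^sub>R F x"
  using F_scaleC[of "of_real r" x] by (simp add: scaleC_of_real)

lemma F_car: "F u * F f + F f * F u = cinner (\<Gamma> u) f *\<^sub>C 1"
  using car[of "\<Gamma> u" f] by (simp add: star_F)

text \<open>For \<open>\<Gamma> g = g\<close> the relations make \<open>F g\<close> selfadjoint with square \<open>(norm g)\<^sup>2 / 2\<close>; a general
  vector is split into its \<open>\<Gamma>\<close>-real and \<open>\<Gamma>\<close>-imaginary parts.\<close>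

lemma norm_F_le: "norm (F f) \<le> 2 * norm f"
proof -
  have real: "norm (F g) \<le> norm g" if "\<Gamma> g = g" for g
  proof (rule power2_le_imp_le)
    have "2 *\<^sub>R (star (F g) * F g) = cinner g g *\<^sub>C 1"
      using car[of g g] that by (simp add: star_F scaleR_2)
    then have "norm (2 *\<^sub>R (star (F g) * F g)) = (norm g)\<^sup>2"
      by (simp only: norm_scaleC cinner_self norm_of_real) simp
    then have "2 * (norm (F g))\<^sup>2 = (norm g)\<^sup>2" by (simp add: cstar_identity)
    then show "(norm (F g))\<^sup>2 \<le> (norm g)\<^sup>2" using zero_le_power2[of "norm (F g)"] by linarith
  qed simp
  define g where "g = (1/2) *\<^sub>R (f + \<Gamma> f)"
  define h where "h = (- \<i> / 2) *\<^sub>C (f - \<Gamma> f)"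
  have f: "f = g + \<i> *\<^sub>C h"
    by (simp add: g_def h_def scaleC_scaleC scaleC_diff_right scaleC_of_real[of "1/2", simplified]
        scaleR_add_right flip: scaleR_add_left)
  have "\<Gamma> g = g" by (simp add: g_def \<Gamma>_scaleR \<Gamma>_add add.commute)
  moreover have "\<Gamma> h = h"
    by (simp add: h_def \<Gamma>_scaleC \<Gamma>_diff scaleC_diff_right scaleC_minus_left)
  ultimately have "norm (F f) \<le> norm g + norm h"
    unfolding f F_add F_scaleC
    by (intro order_trans[OF norm_triangle_ineq] add_mono) (simp_all add: norm_scaleC real)
  also have "\<dots> \<le> norm f + norm f"
  proof (rule add_mono)
    show "norm g \<le> norm f" using norm_triangle_ineq[of f "\<Gamma> f"] by (simp add: g_def)
    show "norm h \<le> norm f"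
      using norm_triangle_ineq4[of f "\<Gamma> f"] by (simp add: h_def norm_scaleC norm_divide)
  qed
  finally show ?thesis by simp
qed

text \<open>On elements of parity \<open>s\<close> (that is, \<open>s = 1\<close> for even and \<open>s = -1\<close> for odd ones) this is the
  antiderivation that contracts with \<open>u\<close>. Carrying the sign as a parameter avoids the parity
  automorphism.\<close>

definition contract :: "real \<Rightarrow> 'k \<Rightarrow> 'a \<Rightarrow> 'a" where
  "contract s u a = F u * a - s *\<^sub>R (a * F u)"

text \<open>Graded Leibniz rule. The sign changes inside because removing the odd factor
  \<open>F f\<close> flips the parity; as an identity it holds for all \<open>s\<close> and
  \<open>a\<close>.\<close>

lemma contract_mult_F:
  "contract s u (F f * a) = cinner (\<Gamma> u) f *\<^sub>C a - F f * contract (- s) u a"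
proof -
  have "cinner (\<Gamma> u) f *\<^sub>C a = (F u * F f + F f * F u) * a"
    by (simp add: F_car mult_scaleC_left)
  then show ?thesis by (simp add: contract_def algebra_simps)
qed

text \<open>In the sum of both orders the terms with \<open>a\<close> between the generators cancel
  by symmetry; the rest is the commutator of \<open>a\<close> with an anticommutator of generators,
  which is a scalar.\<close>

lemma contract_anticommute:
  assumes "\<bar>s\<bar> = 1"
  shows "contract (- s) u (contract s v a) = - contract (- s) v (contract s u a)"
proof -
  have s: "s * s = 1" using assms by (metis abs_mult_self_eq mult_1)
  have eq: "contract (- s) u (contract s v a) =
      F u * F v * a - s *\<^sub>R (F u * a * F v) + s *\<^sub>R (F v * a * F u) - a * (F v * F u)" for u v
    by (simp add: contract_def algebra_simps s)
  have "contract (- s) u (contract s v a) + contract (- s) v (contract s u a) =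
      (F u * F v + F v * F u) * a - a * (F v * F u + F u * F v)"
    unfolding eq by (simp add: algebra_simps)
  also have "\<dots> = 0"
    unfolding F_car cinner_\<Gamma>_commute[of v u] by (simp add: mult_scaleC_left mult_scaleC_right)
  finally show ?thesis by (simp add: eq_neg_iff_add_eq_0)
qed

lemma contract_one: "contract 1 u 1 = 0"
  by (simp add: contract_def)

lemma norm_contract_le:
  assumes "\<bar>s\<bar> = 1" shows "norm (contract s u a) \<le> 4 * norm u * norm a"
proof -
  have "norm (contract s u a) \<le> norm (F u * a) + norm (s *\<^sub>R (a * F u))"
    unfolding contract_def by (rule norm_triangle_ineq4)
  also have "\<dots> \<le> norm (F u) * norm a + norm a * norm (F u)"
    using assms by (intro add_mono) (simp_all add: norm_mult_ineq)
  also have "\<dots> \<le> (2 * norm u) * norm a + norm a * (2 * norm u)"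
    by (intro add_mono mult_right_mono mult_left_mono norm_F_le) simp_all
  finally show ?thesis by (simp add: mult_ac)
qed

lemma contract_add: "contract s u (a + b) = contract s u a + contract s u b"
  and contract_scaleR: "contract s u (r *\<^sub>R a) = r *\<^sub>R contract s u a"
  and contract_minus: "contract s u (- a) = - contract s u a"
  and contract_scaleC: "contract s u (c *\<^sub>C a) = c *\<^sub>C contract s u a"
  by (simp_all add: contract_def algebra_simps mult_scaleC_left mult_scaleC_right scaleC_diff_right scaleC_scaleR)

lemma contract_add_left: "contract s (u + v) a = contract s u a + contract s v a"
  and contract_scaleR_left: "contract s (r *\<^sub>R u) a = r *\<^sub>R contract s u a"
  and contract_scaleC_left: "contract s (c *\<^sub>C u) a = c *\<^sub>C contract s u a"
  by (simp_all add: contract_def F_add F_scaleR F_scaleC algebra_simps mult_scaleC_left mult_scaleC_right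
      scaleC_diff_right scaleC_scaleR)

lemma contract_diff_left: "contract s (u - v) a = contract s u a - contract s v a"
  using contract_add_left[of s "u - v" v a] by simp

lemma bounded_linear_contract: "\<bar>s\<bar> = 1 \<Longrightarrow> bounded_linear (contract s u)"
  by (rule bounded_linear_intro[of _ "4 * norm u"])
     (use norm_contract_le in \<open>simp_all add: contract_add contract_scaleR mult_ac\<close>)

lemma bounded_linear_contract_left: "\<bar>s\<bar> = 1 \<Longrightarrow> bounded_linear (\<lambda>u. contract s u a)"
  by (rule bounded_linear_intro[of _ "4 * norm a"])
     (use norm_contract_le in \<open>simp_all add: contract_add_left contract_scaleR_left mult_ac\<close>)

section \<open>Monomials and elements of definite parity\<close>

definition monomial :: "'k list \<Rightarrow> 'a" where
  "monomial fs = prod_list (map F fs)"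

lemma monomial_simps [simp]: "monomial [] = 1" "monomial (f # fs) = F f * monomial fs"
  by (simp_all add: monomial_def)

lemma monomial_append: "monomial (fs @ gs) = monomial fs * monomial gs"
  by (simp add: monomial_def)

text \<open>Iterated Leibniz rule. The right-hand side has the shape of Wick's recursion, which
  thereby becomes a statement about the bounded map \<open>contract\<close>.\<close>

lemma contract_monomial:
  "contract ((- 1) ^ length fs) u (monomial fs) =
    (\<Sum>j<length fs. ((- 1) ^ j * cinner (\<Gamma> u) (fs ! j)) *\<^sub>C monomial (take j fs @ drop (Suc j) fs))"
proof (induction fs)
  case Nil
  then show ?case by (simp add: contract_one)
next
  case (Cons f fs)
  have "contract ((- 1) ^ length (f # fs)) u (monomial (f # fs)) =
      cinner (\<Gamma> u) f *\<^sub>C monomial fs - F f * contract ((- 1) ^ length fs) u (monomial fs)"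
    by (simp add: contract_mult_F)
  then show ?case
    unfolding Cons
    by (simp add: sum.lessThan_Suc_shift sum_distrib_left mult_scaleC_right scaleC_minus_left sum_negf
        del: sum.lessThan_Suc)
qed

text \<open>\<open>span\<close> is real, hence the complex coefficients in the generators. The
  closure is taken because the infinite sum \<open>shift\<close> may lead out of the span.\<close>

definition parity_space :: "real \<Rightarrow> 'a set" where
  "parity_space s = closure (span {c *\<^sub>C monomial fs | c fs. (- 1) ^ length fs = s})"

lemma subspace_parity_space: "subspace (parity_space s)"
  unfolding parity_space_def by (rule subspace_closure, rule subspace_span)

lemma closed_parity_space: "closed (parity_space s)"
  by (simp add: parity_space_def)

lemma monomial_parity_space: "(- 1) ^ length fs = s \<Longrightarrow> c *\<^sub>C monomial fs \<in> parity_space s"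
  unfolding parity_space_def by (intro subsetD[OF closure_subset] span_base) blast

lemma monomial_parity_space': "(- 1) ^ length fs = s \<Longrightarrow> monomial fs \<in> parity_space s"
  using monomial_parity_space[of fs s 1] by simp

text \<open>With \<open>V\<close> a parity space this yields invariance, with \<open>V = {0}\<close>
  identities between bounded maps.\<close>

lemma parity_space_induct:
  assumes a: "a \<in> parity_space s" and L: "bounded_linear L" and V: "closed V" "subspace V"
    and gen: "\<And>c fs. (- 1) ^ length fs = s \<Longrightarrow> L (c *\<^sub>C monomial fs) \<in> V"
  shows "L a \<in> V"
proof -
  have "span {c *\<^sub>C monomial fs | c fs. (- 1) ^ length fs = s} \<subseteq> L -` V"
    by (rule span_minimal[OF _ linear_subspace_vimage[OF bounded_linear.linear[OF L] V(2)]])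
       (use gen in auto)
  moreover have "closed (L -` V)"
    using V(1) L by (intro continuous_closed_vimage) (simp_all add: linear_continuous_at)
  ultimately have "parity_space s \<subseteq> L -` V"
    unfolding parity_space_def by (rule closure_minimal)
  then show ?thesis using a by blast
qed

text \<open>The sign \<open>s\<close> is unrelated to \<open>t\<close>: both terms of the
  contraction acquire one more odd factor.\<close>

lemma contract_parity_space:
  assumes s: "\<bar>s\<bar> = 1" and a: "a \<in> parity_space t"
  shows "contract s u a \<in> parity_space (- t)"
proof (rule parity_space_induct[OF a bounded_linear_contract[OF s] closed_parity_space subspace_parity_space])
  fix c and fs :: "'k list" assume fs: "(- 1 :: real) ^ length fs = t"
  have "contract s u (c *\<^sub>C monomial fs) =
      c *\<^sub>C monomial (u # fs) - s *\<^sub>R c *\<^sub>C monomial (fs @ [u])"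
    by (simp add: contract_def monomial_append mult_scaleC_left mult_scaleC_right)
  also have "\<dots> \<in> parity_space (- t)"
    using fs by (intro subspace_diff subspace_scale subspace_parity_space monomial_parity_space) simp_all
  finally show "contract s u (c *\<^sub>C monomial fs) \<in> parity_space (- t)" .
qed

subsection \<open>Quasi-free functionals\<close>

lemma two_point:
  assumes "is_quasi_free F S \<phi>" shows "\<phi> (F f * F g) = cinner (\<Gamma> f) (S g)"
proof -
  have "\<phi> (star (F (\<Gamma> f)) * F g) = cinner (\<Gamma> f) (S g)"
    using assms by (simp add: is_quasi_free_def)
  then show ?thesis by (simp add: star_F)
qed

lemma quasi_free_odd:
  assumes "is_quasi_free F S \<phi>" "odd (length fs)" shows "\<phi> (monomial fs) = 0"
  using assms unfolding is_quasi_free_def monomial_def by blast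

lemma quasi_free_Wick:
  assumes "is_quasi_free F S \<phi>" "odd (length fs)"
  shows "\<phi> (F f * monomial fs) = (\<Sum>j<length fs. (- 1) ^ j * cinner (\<Gamma> f) (S (fs ! j)) *
    \<phi> (monomial (take j fs @ drop (Suc j) fs)))"
proof -
  have "\<phi> (prod_list (map F (f # fs))) = (\<Sum>j<length fs. (- 1) ^ j * \<phi> (F f * F (fs ! j)) *
      \<phi> (prod_list (map F (take j fs @ drop (Suc j) fs))))"
    using assms unfolding is_quasi_free_def by blast
  then show ?thesis
    unfolding two_point[OF assms(1)] monomial_def by simp
qed

lemma monomial_in_star_alg: "monomial fs \<in> star_alg (range F)"
  by (induction fs) (auto intro: star_alg.intros)

lemma star_monomial: "star (monomial fs) = monomial (rev (map \<Gamma> fs))"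
  by (induction fs) (simp_all add: star_mult star_F monomial_append)

lemma star_alg_subset_span: "star_alg (range F) \<subseteq> span {c *\<^sub>C monomial fs | c fs. True}"
  (is "_ \<subseteq> span ?G")
proof
  have scale: "c *\<^sub>C a \<in> span ?G" if "a \<in> span ?G" for c a
    using that
  proof (induction rule: span_induct)
    case base
    show ?case unfolding mem_Collect_eq
      by (rule subspaceI) (auto simp: scaleC_add_right scaleC_scaleR span_add span_scale span_zero)
  next
    case (step x)
    then obtain d fs where "x = d *\<^sub>C monomial fs" by blast
    then have "c *\<^sub>C x = (c * d) *\<^sub>C monomial fs" by (simp add: scaleC_scaleC)
    then show ?case by (intro span_base) blast
  qed
  have mult: "a * b \<in> span ?G" if "a \<in> span ?G" "b \<in> span ?G" for a b
    using that(1)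
  proof (induction rule: span_induct)
    case base
    show ?case unfolding mem_Collect_eq
      by (rule subspaceI) (auto simp: distrib_right span_add span_scale span_zero)
  next
    case (step x)
    then obtain c fs where x: "x = c *\<^sub>C monomial fs" by blast
    show ?case using that(2)
    proof (induction rule: span_induct)
      case base
      show ?case unfolding mem_Collect_eq
        by (rule subspaceI) (auto simp: distrib_left span_add span_scale span_zero)
    next
      case (step y)
      then obtain d gs where "y = d *\<^sub>C monomial gs" by blast
      then have "x * y = (c * d) *\<^sub>C monomial (fs @ gs)"
        by (simp add: x mult_scaleC_left mult_scaleC_right scaleC_scaleC monomial_append mult.commute[of d])
      then show ?case by (intro span_base) blast
    qed
  qed
  have star: "star a \<in> span ?G" if "a \<in> span ?G" for a
    using that
  proof (induction rule: span_induct)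
    case base
    have "star (r *\<^sub>R x) = r *\<^sub>R star x" for r and x :: 'a
      using star_scaleC[of "of_real r" x] by (simp add: scaleC_of_real)
    then show ?case unfolding mem_Collect_eq
      by (intro subspaceI) (auto simp: star_add span_add span_scale span_zero)
  next
    case (step x)
    then obtain c fs where "x = c *\<^sub>C monomial fs" by blast
    then have "star x = cnj c *\<^sub>C monomial (rev (map \<Gamma> fs))" by (simp add: star_scaleC star_monomial)
    then show ?case by (intro span_base) blast
  qed
  fix a assume "a \<in> star_alg (range F)"
  then show "a \<in> span ?G"
  proof (induction rule: star_alg.induct)
    case (star_alg_gen a)
    then obtain f where "a = 1 *\<^sub>C monomial [f]" by auto
    then show ?case by (intro span_base) blast
  next
    case star_alg_one
    have "1 = 1 *\<^sub>C monomial []" by simp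
    then show ?case by (intro span_base) blast
  qed (rule span_add scale mult star; assumption)+
qed

text \<open>Transfers what is proved for one constructed functional to every quasi-free functional
  with the same \<open>S\<close>. Wick's recursion shortens monomials by two, so induction on the
  length applies.\<close>

lemma quasi_free_unique:
  assumes \<phi>: "is_quasi_free F S \<phi>" and \<psi>: "is_quasi_free F S \<psi>" and a: "a \<in> star_alg (range F)"
  shows "\<phi> a = \<psi> a"
proof -
  have monomial: "\<phi> (monomial fs) = \<psi> (monomial fs)" for fs
  proof (induction "length fs" arbitrary: fs rule: less_induct)
    case less
    show ?case
    proof (cases "odd (length fs)")
      case True
      then show ?thesis by (simp add: quasi_free_odd[OF \<phi>] quasi_free_odd[OF \<psi>])
    next
      case even: False
      show ?thesis
      proof (cases fs)
        case Nil
        then show ?thesis using \<phi> \<psi> by (simp add: is_quasi_free_def)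
      next
        case (Cons f gs)
        then have odd: "odd (length gs)" using even by simp
        have "\<phi> (monomial (take j gs @ drop (Suc j) gs)) = \<psi> (monomial (take j gs @ drop (Suc j) gs))"
          if "j < length gs" for j
          by (rule less) (use that Cons in simp)
        then show ?thesis 
          unfolding Cons monomial_simps quasi_free_Wick[OF \<phi> odd] quasi_free_Wick[OF \<psi> odd] by (intro sum.cong) auto
      qed
    qed
  qed
  let ?A = "star_alg (range F)"
  have lin: "clinear_on ?A \<phi>" "clinear_on ?A \<psi>" using \<phi> \<psi> by (simp_all add: is_quasi_free_def)
  have "span {c *\<^sub>C monomial fs | c fs. True} \<subseteq> {a \<in> ?A. \<phi> a = \<psi> a}"
  proof (rule span_minimal)
    show "{c *\<^sub>C monomial fs | c fs. True} \<subseteq> {a \<in> ?A. \<phi> a = \<psi> a}"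
      using lin monomial by (auto simp: clinear_on_def monomial_in_star_alg intro: star_alg.intros)
    have scaleR: "r *\<^sub>R a \<in> ?A \<and> \<rho> (r *\<^sub>R a) = r *\<^sub>R \<rho> a"
      if "a \<in> ?A" "clinear_on ?A \<rho>" for r a and \<rho> :: "'a \<Rightarrow> complex"
      using that by (simp add: clinear_on_def star_alg_scaleC flip: scaleC_of_real)
    have "0 \<in> ?A" using star_alg_scaleC[OF star_alg_one, of 0 "range F"] by simp
    show "subspace {a \<in> ?A. \<phi> a = \<psi> a}"
    proof (rule subspaceI)
      show "0 \<in> {a \<in> ?A. \<phi> a = \<psi> a}"
        using scaleR[OF \<open>0 \<in> ?A\<close> lin(1), of 0] scaleR[OF \<open>0 \<in> ?A\<close> lin(2), of 0] by simp
    next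
      show "a + b \<in> {a \<in> ?A. \<phi> a = \<psi> a}"
        if "a \<in> {a \<in> ?A. \<phi> a = \<psi> a}" "b \<in> {a \<in> ?A. \<phi> a = \<psi> a}" for a b
        using lin that by (simp add: clinear_on_def star_alg_add)
    next
      show "r *\<^sub>R a \<in> {a \<in> ?A. \<phi> a = \<psi> a}" if "a \<in> {a \<in> ?A. \<phi> a = \<psi> a}" for r a
        using that scaleR[of a \<phi> r] scaleR[of a \<psi> r] lin by simp
    qed
  qed
  then show ?thesis using a star_alg_subset_span by blast
qed

text \<open>The contraction vector \<open>f - S f = \<Gamma> (S (\<Gamma> f))\<close> satisfies \<open>cinner (\<Gamma> (f - S f)) g = cinner (\<Gamma> f) (S g)\<close>,
  so that Wick's recursion becomes \<open>\<phi> (F f * a) = \<phi> (contract (-1) (f - S f) a)\<close> for odd \<open>a\<close>.\<close>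

context
  fixes S :: "'k \<Rightarrow> 'k" and \<phi> :: "'a \<Rightarrow> complex"
  assumes S: "selfadjoint S" "\<And>x. S x + \<Gamma> (S (\<Gamma> x)) = x"
    and \<phi>: "bounded_clinear \<phi>"
begin

lemma cinner_contraction_vector: "cinner (\<Gamma> (f - S f)) g = cinner (\<Gamma> f) (S g)"
proof -
  have "f - S f = \<Gamma> (S (\<Gamma> f))" using S(2)[of f] by (simp add: algebra_simps)
  then show ?thesis using S(1) by (simp add: selfadjoint_def is_adjoint_def)
qed

lemma \<phi>_contract_monomial:
  assumes "odd (length fs)"
  shows "\<phi> (contract (- 1) (f - S f) (monomial fs)) =
    (\<Sum>j<length fs. (- 1) ^ j * cinner (\<Gamma> f) (S (fs ! j)) * \<phi> (monomial (take j fs @ drop (Suc j) fs)))"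
proof -
  have "\<phi> (\<Sum>i\<in>I. g i) = (\<Sum>i\<in>I. \<phi> (g i))" for g :: "nat \<Rightarrow> 'a" and I
    by (rule linear_sum[OF bounded_linear.linear[OF bounded_clinear_imp_bounded_linear[OF \<phi>]]])
  then show ?thesis
    using contract_monomial[of fs "f - S f"] assms
    by (simp add: bounded_clinear_scaleC[OF \<phi>] cinner_contraction_vector scaleC_complex_def)
qed

lemma quasi_freeI:
  assumes one: "\<phi> 1 = 1" and odd: "\<And>a. a \<in> parity_space (- 1) \<Longrightarrow> \<phi> a = 0"
    and wick: "\<And>f a. a \<in> parity_space (- 1) \<Longrightarrow> \<phi> (F f * a) = \<phi> (contract (- 1) (f - S f) a)"
  shows "is_quasi_free F S \<phi>"
proof -
  have wick': "\<phi> (F f * monomial fs) = (\<Sum>j<length fs. (- 1) ^ j * cinner (\<Gamma> f) (S (fs ! j)) *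
      \<phi> (monomial (take j fs @ drop (Suc j) fs)))" if "odd (length fs)" for f fs
    using wick[of "monomial fs" f] that by (simp add: monomial_parity_space' \<phi>_contract_monomial)
  have two: "\<phi> (F f * F g) = cinner (\<Gamma> f) (S g)" for f g
    using wick'[of "[g]" f] by (simp add: one)
  show ?thesis
    unfolding is_quasi_free_def
  proof (intro conjI allI impI)
    show "clinear_on (star_alg (range F)) \<phi>"
      using \<phi> by (auto simp: bounded_clinear_def clinear_on_def)
    show "\<phi> (prod_list (map F fs)) = 0" if "odd (length fs)" for fs
      using odd[OF monomial_parity_space'[of fs "- 1"]] that by (simp add: monomial_def)
    show "\<phi> (star (F f) * F g) = cinner f (S g)" for f g by (simp add: star_F two)
    show "\<phi> (prod_list (map F (f # fs))) = (\<Sum>j<length fs. (-1) ^ j * \<phi> (F f * F (fs ! j)) *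
           \<phi> (prod_list (map F (take j fs @ drop (Suc j) fs))))" if "odd (length fs)" for f fs
      using wick'[OF that, of f] unfolding two monomial_def by simp
  qed (rule one)
qed

text \<open>Both clauses hold on odd monomials and pass to the closure by boundedness of
  \<open>\<phi>\<close>. This is the form in which Wick's rule is later applied to
  \<open>(shift (- 1) ^^ n) a\<close>.\<close>

lemma quasi_freeD:
  assumes qf: "is_quasi_free F S \<phi>" and a: "a \<in> parity_space (- 1)"
  shows "\<phi> a = 0" and "\<phi> (F f * a) = \<phi> (contract (- 1) (f - S f) a)"
proof -
  note \<phi>_bl = bounded_clinear_imp_bounded_linear[OF \<phi>]
  have pow: "odd (length fs)" if "(- 1 :: real) ^ length fs = - 1" for fs :: "'k list"
    using that by (cases "even (length fs)") simp_all
  have "\<phi> a \<in> {0}"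
  proof (rule parity_space_induct[OF a \<phi>_bl])
    fix c and fs :: "'k list" assume "(- 1 :: real) ^ length fs = - 1"
    then show "\<phi> (c *\<^sub>C monomial fs) \<in> {0}"
      by (simp add: bounded_clinear_scaleC[OF \<phi>] quasi_free_odd[OF qf pow] scaleC_complex_def)
  qed (simp_all add: subspace_0)
  then show "\<phi> a = 0" by simp
  have bl: "bounded_linear (\<lambda>a. \<phi> (F f * a) - \<phi> (contract (- 1) (f - S f) a))"
    by (intro bounded_linear_sub bounded_linear_compose[OF \<phi>_bl] bounded_linear_mult_right
        bounded_linear_contract) simp
  have "\<phi> (F f * a) - \<phi> (contract (- 1) (f - S f) a) \<in> {0}"
  proof (rule parity_space_induct[OF a bl])
    fix c and fs :: "'k list" assume *: "(- 1 :: real) ^ length fs = - 1"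
    have "\<phi> (F f * monomial fs) = \<phi> (contract (- 1) (f - S f) (monomial fs))"
      unfolding \<phi>_contract_monomial[OF pow[OF *]] by (rule quasi_free_Wick[OF qf pow[OF *]])
    then show "\<phi> (F f * (c *\<^sub>C monomial fs)) - \<phi> (contract (- 1) (f - S f) (c *\<^sub>C monomial fs)) \<in> {0}"
      by (simp add: mult_scaleC_right contract_scaleC bounded_clinear_scaleC[OF \<phi>])
  qed (simp_all add: subspace_0)
  then show "\<phi> (F f * a) = \<phi> (contract (- 1) (f - S f) a)" by simp
qed

end

end

section \<open>Trace-class shifts of quasi-free functionals\<close>

text \<open>Here \<open>'a\<close> is the one-particle space and \<open>'b\<close> the algebra. In
  the application \<open>v k = \<Gamma> (w k)\<close> for rank-one terms given by \<open>y k\<close>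
  and \<open>w k\<close>.\<close>

locale CAR_shift = selfdual_CAR +
  fixes y v :: "nat \<Rightarrow> 'a"
  assumes summable_yv: "summable (\<lambda>k. norm (y k) * norm (v k))"
begin

text \<open>The inner contraction flips the parity, which is why the outer one carries
  \<open>- s\<close>.\<close>

definition shift_term :: "real \<Rightarrow> nat \<Rightarrow> 'b \<Rightarrow> 'b" where
  "shift_term s k a = (- 1 / 2) *\<^sub>R contract (- s) (y k) (contract s (v k) a)"

definition shift :: "real \<Rightarrow> 'b \<Rightarrow> 'b" where
  "shift s a = (\<Sum>k. shift_term s k a)"

text \<open>The constant is 4 * 4 / 2: a factor 4 from the bound on each contraction, halved by the
  prefactor of \<open>shift_term\<close>.\<close>

definition weight :: real where
  "weight = (\<Sum>k. 8 * (norm (y k) * norm (v k)))"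

lemma norm_shift_term_le:
  assumes "\<bar>s\<bar> = 1"
  shows "norm (shift_term s k a) \<le> 8 * (norm (y k) * norm (v k)) * norm a"
proof -
  have "norm (contract (- s) (y k) (contract s (v k) a)) \<le> 4 * norm (y k) * norm (contract s (v k) a)"
    using assms by (intro norm_contract_le) simp
  also have "\<dots> \<le> 4 * norm (y k) * (4 * norm (v k) * norm a)"
    using assms by (intro mult_left_mono norm_contract_le) simp_all
  finally show ?thesis by (simp add: shift_term_def)
qed

lemma shift_sums:
  assumes "\<bar>s\<bar> = 1" shows "(\<lambda>k. shift_term s k a) sums shift s a"
  unfolding shift_def
  by (rule summable_sums, rule summable_comparison_test'[OF
        summable_mult2[OF summable_mult[OF summable_yv, of 8], of "norm a"], where N=0])
     (rule norm_shift_term_le[OF assms])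

lemma shift_term_add: "shift_term s k (a + b) = shift_term s k a + shift_term s k b"
  and shift_term_scaleR: "shift_term s k (r *\<^sub>R a) = r *\<^sub>R shift_term s k a"
  by (simp_all add: shift_term_def contract_add contract_scaleR scaleR_add_right scaleR_left_commute)

lemma bounded_linear_shift:
  assumes s: "\<bar>s\<bar> = 1" shows "bounded_linear (shift s)"
proof (rule bounded_linear_intro)
  show "shift s (a + b) = shift s a + shift s b" for a b
    using sums_unique2[OF shift_sums[OF s]] sums_add[OF shift_sums[OF s] shift_sums[OF s]]
    by (simp add: shift_term_add)
  show "shift s (r *\<^sub>R a) = r *\<^sub>R shift s a" for r a
    using sums_unique2[OF shift_sums[OF s]] sums_scaleR_right[OF shift_sums[OF s]]
    by (simp add: shift_term_scaleR)
  show "norm (shift s a) \<le> norm a * weight" for a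
  proof -
    have sm: "summable (\<lambda>k. 8 * (norm (y k) * norm (v k)))" by (rule summable_mult[OF summable_yv])
    have "norm (shift s a) \<le> (\<Sum>k. 8 * (norm (y k) * norm (v k)) * norm a)"
      unfolding shift_def by (rule norm_suminf_le[OF norm_shift_term_le[OF s] summable_mult2[OF sm]])
    also have "\<dots> = weight * norm a" unfolding weight_def by (rule suminf_mult2[OF sm, symmetric])
    finally show ?thesis by (simp add: mult.commute)
  qed
qed

lemma shift_add: "\<bar>s\<bar> = 1 \<Longrightarrow> shift s (a + b) = shift s a + shift s b"
  by (rule linear_add[OF bounded_linear.linear[OF bounded_linear_shift]])

lemma shift_scaleR: "\<bar>s\<bar> = 1 \<Longrightarrow> shift s (r *\<^sub>R a) = r *\<^sub>R shift s a"
  by (rule linear_scale[OF bounded_linear.linear[OF bounded_linear_shift]])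

lemma shift_one: "shift 1 1 = 0"
proof -
  have "contract s u 0 = 0" for s u by (simp add: contract_def)
  then show ?thesis by (simp add: shift_def shift_term_def contract_one)
qed

lemma shift_parity_space:
  assumes s: "\<bar>s\<bar> = 1" and a: "a \<in> parity_space t"
  shows "shift s a \<in> parity_space t"
proof (rule closed_sequentially[OF closed_parity_space])
  show "(\<lambda>n. \<Sum>k<n. shift_term s k a) \<longlonglongrightarrow> shift s a" using shift_sums[OF s] by (simp add: sums_def)
  have "shift_term s k a \<in> parity_space t" for k
  proof -
    have "contract (- s) (y k) (contract s (v k) a) \<in> parity_space (- (- t))"
      using s by (intro contract_parity_space a) simp_all
    then show ?thesis unfolding shift_term_def by (intro subspace_scale[OF subspace_parity_space]) simp
  qed
  then show "(\<Sum>k<n. shift_term s k a) \<in> parity_space t" for n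
    by (intro subspace_sum[OF subspace_parity_space])
qed

text \<open>Two anticommutations, one for each contraction in a term, cancel each other's sign. The
  index of \<open>shift\<close> follows the parity of its argument, so it changes when the
  contraction moves across.\<close>

lemma shift_contract:
  assumes s: "\<bar>s\<bar> = 1"
  shows "shift s (contract (- s) u a) = contract (- s) u (shift (- s) a)"
proof (rule sums_unique2[OF shift_sums[OF s]])
  have "shift_term s k (contract (- s) u a) = contract (- s) u (shift_term (- s) k a)" for k
  proof -
    have "contract s (v k) (contract (- s) u a) = - contract s u (contract (- s) (v k) a)"
      using contract_anticommute[of "- s" "v k" u a] s by simp
    then show ?thesis
      using contract_anticommute[OF s, of "y k" u "contract (- s) (v k) a"]
      by (simp add: shift_term_def contract_minus contract_scaleR)
  qed
  moreover have "(\<lambda>k. contract (- s) u (shift_term (- s) k a)) sums contract (- s) u (shift (- s) a)"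
    using s by (intro bounded_linear.sums[OF bounded_linear_contract] shift_sums) simp_all
  ultimately show "(\<lambda>k. shift_term s k (contract (- s) u a)) sums contract (- s) u (shift (- s) a)"
    by simp
qed

lemma shift_power_contract:
  "(shift 1 ^^ n) (contract (- 1) u a) = contract (- 1) u ((shift (- 1) ^^ n) a)"
  using shift_contract[of 1 u] by (induction n) simp_all

context
  fixes T :: "'a \<Rightarrow> 'a"
  assumes T: "\<And>f. (\<lambda>k. cinner (\<Gamma> (v k)) f *\<^sub>C y k - cinner (\<Gamma> (y k)) f *\<^sub>C v k) sums (2 *\<^sub>R T f)"
begin

text \<open>The Leibniz rule is applied twice: besides the term in which neither contraction meets
  \<open>F f\<close>, each of the two meets it once, with opposite signs. Antisymmetry of
  \<open>T\<close> makes these contributions sum to \<open>2 *\<^sub>R T f\<close>, and the factor -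
  1/2 is chosen to turn this into \<open>- T f\<close>.\<close>

lemma shift_mult_F:
  assumes s: "\<bar>s\<bar> = 1"
  shows "shift s (F f * a) = F f * shift (- s) a - contract (- s) (T f) a"
proof (rule sums_unique2[OF shift_sums[OF s]])
  have ms: "\<bar>- s\<bar> = 1" using s by simp
  have "shift_term s k (F f * a) = F f * shift_term (- s) k a +
      (- 1 / 2) *\<^sub>R contract (- s) (cinner (\<Gamma> (v k)) f *\<^sub>C y k - cinner (\<Gamma> (y k)) f *\<^sub>C v k) a" for k
  proof -
    have "contract s (v k) (F f * a) = cinner (\<Gamma> (v k)) f *\<^sub>C a + - (F f * contract (- s) (v k) a)"
      by (simp add: contract_mult_F)
    then show ?thesis
      unfolding shift_term_def
      by (simp only: contract_add contract_minus contract_scaleC contract_mult_F contract_diff_left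
          contract_scaleC_left) (simp add: algebra_simps)
  qed
  moreover have "(\<lambda>k. F f * shift_term (- s) k a +
      (- 1 / 2) *\<^sub>R contract (- s) (cinner (\<Gamma> (v k)) f *\<^sub>C y k - cinner (\<Gamma> (y k)) f *\<^sub>C v k) a)
      sums (F f * shift (- s) a + (- 1 / 2) *\<^sub>R contract (- s) (2 *\<^sub>R T f) a)"
    by (intro sums_add sums_scaleR_right bounded_linear.sums[OF bounded_linear_mult_right]
        shift_sums[OF ms] bounded_linear.sums[OF bounded_linear_contract_left[OF ms] T])
  ultimately show "(\<lambda>k. shift_term s k (F f * a)) sums (F f * shift (- s) a - contract (- s) (T f) a)"
    by (simp add: contract_scaleR_left)
qed

text \<open>The correction from moving \<open>F f\<close> past one \<open>shift\<close> is a
  contraction, which commutes with the remaining ones, so all \<open>n\<close> factors contribute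
  equally. At \<open>n = 0\<close> the truncated \<open>n - 1\<close> is harmless because its
  coefficient is zero.\<close>

lemma shift_power_mult_F:
  "(shift 1 ^^ n) (F f * a) = F f * (shift (- 1) ^^ n) a
    - real n *\<^sub>R contract (- 1) (T f) ((shift (- 1) ^^ (n - 1)) a)"
proof (induction n)
  case (Suc n)
  let ?b = "(shift (- 1) ^^ n) a" and ?c = "(shift (- 1) ^^ (n - 1)) a"
  have "real n *\<^sub>R shift (- 1) ?c = real n *\<^sub>R ?b" by (cases n) simp_all
  then have "real n *\<^sub>R contract (- 1) (T f) (shift (- 1) ?c) = real n *\<^sub>R contract (- 1) (T f) ?b"
    by (metis contract_scaleR)
  moreover have "shift 1 (F f * ?b + (- real n) *\<^sub>R contract (- 1) (T f) ?c) =
      F f * shift (- 1) ?b - contract (- 1) (T f) ?b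
      + (- real n) *\<^sub>R contract (- 1) (T f) (shift (- 1) ?c)"
    using shift_mult_F[of 1 f ?b] shift_contract[of 1 "T f" ?c] by (simp add: shift_add shift_scaleR del: scaleR_minus_left)
  ultimately have "shift 1 (F f * ?b + (- real n) *\<^sub>R contract (- 1) (T f) ?c) =
      F f * shift (- 1) ?b - contract (- 1) (T f) ?b - real n *\<^sub>R contract (- 1) (T f) ?b"
    by simp
  moreover have "(shift 1 ^^ Suc n) (F f * a) = shift 1 (F f * ?b + (- real n) *\<^sub>R contract (- 1) (T f) ?c)"
    using Suc by simp
  ultimately show ?case by (simp add: scaleR_add_left)
qed simp

text \<open>The functional is \<open>\<phi>\<^sub>R \<circ> exp (shift 1)\<close>: moving \<open>F f\<close> out of the exponential changes the contraction
  vector \<open>f - R f\<close> of Wick's recursion by \<open>- T f\<close>.\<close>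

lemma quasi_free_exp_shift:
  fixes \<phi>\<^sub>R \<phi> :: "'b \<Rightarrow> complex"
  assumes R: "selfadjoint R" "\<And>x. R x + \<Gamma> (R (\<Gamma> x)) = x" "is_quasi_free F R \<phi>\<^sub>R" "bounded_clinear \<phi>\<^sub>R"
    and S: "selfadjoint S" "\<And>x. S x + \<Gamma> (S (\<Gamma> x)) = x" "\<And>x. S x = R x + T x"
    and \<phi>: "bounded_clinear \<phi>" "\<And>a. (\<lambda>n. (1 / fact n) *\<^sub>R \<phi>\<^sub>R ((shift 1 ^^ n) a)) sums \<phi> a"
  shows "is_quasi_free F S \<phi>"
proof (rule quasi_freeI[OF S(1,2) \<phi>(1)])
  note R_bl = bounded_clinear_imp_bounded_linear[OF R(4)]
  note R_lin = linear_diff[OF bounded_linear.linear[OF R_bl]] linear_scale[OF bounded_linear.linear[OF R_bl]]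
    linear_add[OF bounded_linear.linear[OF R_bl]]
  note qfR = quasi_freeD[OF R(1,2,4,3)]
  have "shift 1 0 = 0" using shift_scaleR[of 1 0 0] by simp
  then have pow1: "(shift 1 ^^ n) 1 = (if n = 0 then 1 else 0)" for n
    by (induction n) (auto simp: shift_one)
  have "\<phi>\<^sub>R 1 = 1" using R(3) by (simp add: is_quasi_free_def)
  moreover have "\<phi>\<^sub>R 0 = 0" using R_lin(2)[of 0 0] by simp
  ultimately have "(1 / fact n) *\<^sub>R \<phi>\<^sub>R ((shift 1 ^^ n) 1) = (if n = 0 then 1 else 0)" for n
    by (simp add: pow1)
  then have "(\<lambda>n. if n = 0 then 1 else 0) sums \<phi> 1" using \<phi>(2)[of 1] by simp
  then show "\<phi> 1 = 1"
    using sums_unique2 sums_single[of 0 "\<lambda>_. 1 :: complex"] by fastforce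
  have odd_pow: "(shift s ^^ n) a \<in> parity_space (- 1)" if "a \<in> parity_space (- 1)" "\<bar>s\<bar> = 1" for s a n
    using that by (induction n) (auto intro: shift_parity_space)
  show "\<phi> a = 0" if a: "a \<in> parity_space (- 1)" for a
    using \<phi>(2)[of a] qfR(1)[OF odd_pow[OF a]] sums_unique2[OF _ sums_zero] by simp
  show "\<phi> (F f * a) = \<phi> (contract (- 1) (f - S f) a)" if a: "a \<in> parity_space (- 1)" for f a
  proof (rule sums_unique2[OF \<phi>(2)])
    define A B where "A = contract (- 1) (f - R f) a" and "B = contract (- 1) (T f) a"
    define X where "X n b = \<phi>\<^sub>R ((shift 1 ^^ n) b)" for n b
    \<comment> \<open>Wick's rule for \<open>R\<close> is applied to the odd element
      \<open>(shift (- 1) ^^ n) a\<close>; the resulting contraction is then moved back inside the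
      powers of \<open>shift\<close>.\<close>
    have X_F: "X n (F f * a) = X n A - real n *\<^sub>R X (n - 1) B" for n
      unfolding X_def A_def B_def shift_power_contract shift_power_mult_F R_lin
      by (simp add: qfR(2)[OF odd_pow[OF a]])
    \<comment> \<open>The factor \<open>n\<close> turns \<open>1 / fact n\<close> into
      \<open>1 / fact (n - 1)\<close>: the corrections form the exponential series for
      \<open>B\<close>, moved by one index.\<close>
    have "(\<lambda>n. (real (Suc n) / fact (Suc n)) *\<^sub>R X n B) sums \<phi> B"
      using \<phi>(2)[of B] by (simp add: X_def divide_simps del: of_nat_Suc)
    then have "(\<lambda>n. (real n / fact n) *\<^sub>R X (n - 1) B) sums \<phi> B"
      using sums_Suc_iff[of "\<lambda>n. (real n / fact n) *\<^sub>R X (n - 1) B" "\<phi> B"] by simp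
    then have "(\<lambda>n. (1 / fact n) *\<^sub>R X n A - (real n / fact n) *\<^sub>R X (n - 1) B) sums (\<phi> A - \<phi> B)"
      using \<phi>(2)[of A] by (intro sums_diff) (simp_all add: X_def)
    also have "\<phi> A - \<phi> B = \<phi> (A - B)"
      by (rule linear_diff[OF bounded_linear.linear[OF bounded_clinear_imp_bounded_linear[OF \<phi>(1)]], symmetric])
    also have "A - B = contract (- 1) (f - S f) a"
      by (simp add: A_def B_def S(3) flip: contract_diff_left) (simp add: algebra_simps)
    finally show "(\<lambda>n. (1 / fact n) *\<^sub>R \<phi>\<^sub>R ((shift 1 ^^ n) (F f * a))) sums \<phi> (contract (- 1) (f - S f) a)"
      unfolding X_def[symmetric] X_F by (simp add: scaleR_diff_right)
  qed
qed

end

section \<open>Vector series composed with contractions and with the exponential\<close>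

context
  fixes \<pi> :: "'b \<Rightarrow> 'h::chilbert_space \<Rightarrow> 'h"
  assumes rep: "is_representation \<pi>"
begin

lemma vector_series_contract:
  assumes \<omega>: "vector_series \<pi> C \<omega>" and s: "\<bar>s\<bar> = 1"
  shows "vector_series \<pi> (4 * norm u * C) (\<lambda>a. \<omega> (contract s u a))"
proof -
  note \<omega>_linear = bounded_linear.linear[OF bounded_clinear_imp_bounded_linear[OF
        vector_series_bounded_clinear[OF rep \<omega>]]]
  have "vector_series \<pi> (norm (F u) * C + \<bar>- s\<bar> * (norm (F u) * C))
      (\<lambda>a. \<omega> (F u * a) + (- s) *\<^sub>R \<omega> (a * F u))"
    by (intro vector_series_add[OF rep] vector_series_scaleR[OF rep] vector_series_mult_left[OF rep]
        vector_series_mult_right[OF rep] \<omega>)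
  also have "(\<lambda>a. \<omega> (F u * a) + (- s) *\<^sub>R \<omega> (a * F u)) = (\<lambda>a. \<omega> (contract s u a))"
    by (simp add: contract_def linear_diff[OF \<omega>_linear] linear_scale[OF \<omega>_linear])
  finally show ?thesis
  proof (rule vector_series_mono)
    have "C * norm (F u) \<le> C * (2 * norm u)"
      by (intro mult_left_mono norm_F_le vector_series_nonneg[OF rep \<omega>])
    then show "norm (F u) * C + \<bar>- s\<bar> * (norm (F u) * C) \<le> 4 * norm u * C"
      using s by (simp add: mult_ac)
  qed
qed

lemma vector_series_shift:
  assumes \<omega>: "vector_series \<pi> C \<omega>" and s: "\<bar>s\<bar> = 1"
  shows "vector_series \<pi> (weight * C) (\<lambda>a. \<omega> (shift s a))"
proof -
  note \<omega>_bl = bounded_clinear_imp_bounded_linear[OF vector_series_bounded_clinear[OF rep \<omega>]]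
  have ms: "\<bar>- s\<bar> = 1" using s by simp
  have "vector_series \<pi> (8 * (norm (y k) * norm (v k)) * C) (\<lambda>a. \<omega> (shift_term s k a))" for k
    using vector_series_scaleR[OF rep vector_series_contract[OF vector_series_contract[OF \<omega> ms] s], of "- 1 / 2" "v k" "y k"]
    by (simp add: shift_term_def linear_scale[OF bounded_linear.linear[OF \<omega>_bl]] linear_neg[OF bounded_linear.linear[OF \<omega>_bl]] mult_ac)
  then have "vector_series \<pi> (\<Sum>k. 8 * (norm (y k) * norm (v k)) * C) (\<lambda>a. \<omega> (shift s a))"
    by (rule vector_series_suminf[OF rep _ summable_mult2[OF summable_mult[OF summable_yv]]])
       (rule bounded_linear.sums[OF \<omega>_bl shift_sums[OF s]])
  then show ?thesis
    unfolding weight_def suminf_mult2[OF summable_mult[OF summable_yv], symmetric] .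
qed

text \<open>Each composition with \<open>shift\<close> multiplies the bound by
  \<open>weight\<close>, so the bounds of the terms add up to an exponential, and the sum is again a
  single series of vector functionals.\<close>

lemma vector_series_exp_shift:
  assumes \<omega>: "vector_series \<pi> C \<omega>" and s: "\<bar>s\<bar> = 1"
  obtains \<phi> where "vector_series \<pi> (exp weight * C) \<phi>"
    and "\<And>a. (\<lambda>n. (1 / fact n) *\<^sub>R \<omega> ((shift s ^^ n) a)) sums \<phi> a"
proof -
  have pow: "vector_series \<pi> (weight ^ n * C) (\<lambda>a. \<omega> ((shift s ^^ n) a))" for n
  proof (induction n)
    case (Suc n)
    then show ?case
      using vector_series_shift[OF Suc s] by (simp add: mult.assoc funpow_swap1)
  qed (use \<omega> in simp)
  have summand: "vector_series \<pi> (weight ^ n /\<^sub>R fact n * C) (\<lambda>a. (1 / fact n) *\<^sub>R \<omega> ((shift s ^^ n) a))" for n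
    using vector_series_scaleR[OF rep pow[of n], of "1 / fact n"] by (simp add: field_simps)
  have C_sums: "(\<lambda>n. weight ^ n /\<^sub>R fact n * C) sums (exp weight * C)"
    by (rule sums_mult2[OF exp_converges])
  define \<phi> where "\<phi> a = (\<Sum>n. (1 / fact n) *\<^sub>R \<omega> ((shift s ^^ n) a))" for a
  have sums: "(\<lambda>n. (1 / fact n) *\<^sub>R \<omega> ((shift s ^^ n) a)) sums \<phi> a" for a
    unfolding \<phi>_def
  proof (rule summable_sums, rule summable_comparison_test'[OF summable_mult2[OF sums_summable[OF C_sums], of "norm a"], where N=0])
    show "norm ((1 / fact n) *\<^sub>R \<omega> ((shift s ^^ n) a)) \<le> weight ^ n /\<^sub>R fact n * C * norm a" for n
      by (rule vector_series_bound[OF rep summand])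
  qed
  have "vector_series \<pi> (exp weight * C) \<phi>"
    using vector_series_suminf[OF rep summand sums_summable[OF C_sums] sums] sums_unique[OF C_sums] by simp
  then show thesis using sums by (rule that)
qed

end

end

text \<open>Existence is part of the conclusion because the universal claim could otherwise be
  vacuous; one constructed functional serves for both.\<close>

theorem theoremA3:
  fixes \<Gamma> R S :: "'k::chilbert_space \<Rightarrow> 'k"
    and F :: "'k \<Rightarrow> 'a::unital_cstar_algebra"
    and \<phi>\<^sub>R :: "'a \<Rightarrow> complex"
    and \<pi> :: "'a \<Rightarrow> 'h::chilbert_space \<Rightarrow> 'h"
    and \<Omega> :: 'h
  assumes "separable_space (euclidean :: 'k topology)"
    and "antiunitary_involution \<Gamma>"
    and "bounded_clinear R" and "selfadjoint R"
    and "bounded_clinear S" and "selfadjoint S"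
    and "op_le (\<lambda>x. 0) R" and "op_le R (\<lambda>x. x)"
    and "\<forall>x. R x + \<Gamma> (R (\<Gamma> x)) = x"
    and "\<forall>x. S x + \<Gamma> (S (\<Gamma> x)) = x"
    and "trace_class (\<lambda>x. S x - R x)"
    and "is_selfdual_CAR \<Gamma> F"
    and "is_state \<phi>\<^sub>R" and "is_quasi_free F R \<phi>\<^sub>R"
    and "is_GNS \<phi>\<^sub>R \<pi> \<Omega>"
  shows "(\<exists>\<phi>\<^sub>S. is_quasi_free F S \<phi>\<^sub>S) \<and>
    (\<forall>\<phi>\<^sub>S. is_quasi_free F S \<phi>\<^sub>S \<longrightarrow>
       bounded_on (star_alg (range F)) \<phi>\<^sub>S \<and>
       (\<exists>\<phi>. bounded_clinear \<phi> \<and> (\<forall>a\<in>star_alg (range F). \<phi> a = \<phi>\<^sub>S a) \<and> normal_in_rep \<pi> \<phi>))"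
proof -
  interpret selfdual_CAR \<Gamma> F
    using assms(2,12) unfolding is_selfdual_CAR_def by unfold_locales blast+
  define T where "T x = S x - R x" for x
  have T_sa: "cinner (T x) z = cinner x (T z)" for x z
    using assms(4,6)
    by (simp add: T_def selfadjoint_def is_adjoint_def cinner_diff_left cinner_diff_right)
  \<comment> \<open>The identity operators in the conditions on \<open>R\<close> and
    \<open>S\<close> cancel, leaving the antisymmetry of \<open>T\<close> under the
    involution.\<close>
  have \<Gamma>T: "\<Gamma> (T (\<Gamma> x)) = - T x" for x
    using assms(9)[rule_format, of x] assms(10)[rule_format, of x]
    by (simp add: T_def \<Gamma>_diff algebra_simps)
  obtain y w where norm_y: "\<And>k. norm (y k) = norm (w k)" and w: "summable (\<lambda>k::nat. (norm (w k))\<^sup>2)"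
    and T_sums: "\<And>x. (\<lambda>k. cinner (w k) x *\<^sub>C y k) sums T x"
    by (rule trace_class_decomposition[OF assms(11), folded T_def]) (rule that)
  \<comment> \<open>\<open>contract\<close> pairs through \<open>cinner (\<Gamma> u)\<close>, so
    \<open>\<Gamma> (v k) = w k\<close> restores the rank-one terms of \<open>T\<close>.\<close>
  define v where "v k = \<Gamma> (w k)" for k
  interpret CAR_shift \<Gamma> F y v
    by unfold_locales (use w in \<open>simp add: v_def norm_y power2_eq_square\<close>)
  \<comment> \<open>The second series represents the adjoint of \<open>T\<close> conjugated by
    \<open>\<Gamma>\<close>, which is \<open>- T\<close>. Absolute summability provides its limit
    \<open>X\<close>, which is then identified through its inner products with arbitrary
    \<open>z\<close>.\<close>
  have sums: "(\<lambda>k. cinner (\<Gamma> (v k)) f *\<^sub>C y k - cinner (\<Gamma> (y k)) f *\<^sub>C v k) sums (2 *\<^sub>R T f)" for f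
  proof -
    have "summable (\<lambda>k. cinner (\<Gamma> (y k)) f *\<^sub>C v k)"
    proof (rule summable_comparison_test'[OF summable_mult2[OF w, of "norm f"], where N=0])
      show "norm (cinner (\<Gamma> (y k)) f *\<^sub>C v k) \<le> (norm (w k))\<^sup>2 * norm f" for k
        using mult_right_mono[OF cinner_Cauchy_Schwarz[of "\<Gamma> (y k)" f], of "norm (w k)"]
        by (simp add: norm_scaleC v_def norm_y power2_eq_square mult_ac)
    qed
    then obtain X where X: "(\<lambda>k. cinner (\<Gamma> (y k)) f *\<^sub>C v k) sums X" by (auto simp: summable_def)
    have "cinner z X = cinner z (- T f)" for z
    proof (rule sums_unique2)
      show "(\<lambda>k. cinner z (cinner (\<Gamma> (y k)) f *\<^sub>C v k)) sums cinner z X"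
        by (rule bounded_linear.sums[OF bounded_linear_cinner_right X])
      have "cinner z (cinner (\<Gamma> (y k)) f *\<^sub>C v k) = cinner (\<Gamma> f) (cinner (w k) (\<Gamma> z) *\<^sub>C y k)" for k
        using cinner_\<Gamma>_\<Gamma>[of "v k" z] cinner_\<Gamma>_commute[of "y k" f]
        by (simp add: cinner_scaleC_right v_def)
      moreover have "cinner (\<Gamma> f) (T (\<Gamma> z)) = cinner z (- T f)"
      proof -
        have "T (\<Gamma> f) = \<Gamma> (- T f)" by (metis \<Gamma>T \<Gamma>_\<Gamma>)
        then show ?thesis by (metis T_sa cinner_\<Gamma>_\<Gamma>)
      qed
      ultimately show "(\<lambda>k. cinner z (cinner (\<Gamma> (y k)) f *\<^sub>C v k)) sums cinner z (- T f)"
        using bounded_linear.sums[OF bounded_linear_cinner_right T_sums, of "\<Gamma> f" "\<Gamma> z"] by simp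
    qed
    then have "cinner (X + T f) (X + T f) = 0" by (simp add: cinner_add_right cinner_minus_right)
    then have "X = - T f" by (simp add: cinner_self eq_neg_iff_add_eq_0)
    then show ?thesis
      using sums_diff[OF T_sums X] by (simp add: v_def scaleR_2)
  qed
  have rep: "is_representation \<pi>" and \<phi>\<^sub>R: "\<phi>\<^sub>R = (\<lambda>a. cinner \<Omega> (\<pi> a \<Omega>))"
    using assms(15) by (auto simp: is_GNS_def)
  have series_R: "vector_series \<pi> (norm \<Omega> * norm \<Omega>) \<phi>\<^sub>R"
    unfolding \<phi>\<^sub>R by (rule vector_series_single[OF rep])
  obtain \<phi> where \<phi>: "vector_series \<pi> (exp weight * (norm \<Omega> * norm \<Omega>)) \<phi>"
    "\<And>a. (\<lambda>n. (1 / fact n) *\<^sub>R \<phi>\<^sub>R ((shift 1 ^^ n) a)) sums \<phi> a"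
    by (rule vector_series_exp_shift[OF rep series_R abs_one]) (rule that)
  have bounded: "bounded_clinear \<phi>" by (rule vector_series_bounded_clinear[OF rep \<phi>(1)])
  have qf: "is_quasi_free F S \<phi>"
  proof (rule quasi_free_exp_shift[OF sums])
    show "is_quasi_free F R \<phi>\<^sub>R" "selfadjoint R" "selfadjoint S" by fact+
    show "bounded_clinear \<phi>\<^sub>R" by (rule vector_series_bounded_clinear[OF rep series_R])
    show "R x + \<Gamma> (R (\<Gamma> x)) = x" "S x + \<Gamma> (S (\<Gamma> x)) = x" "S x = R x + T x" for x
      using assms(9,10) by (simp_all add: T_def)
  qed (rule bounded \<phi>(2))+
  have "bounded_on (star_alg (range F)) \<phi>\<^sub>S \<and>
      (\<exists>\<phi>. bounded_clinear \<phi> \<and> (\<forall>a\<in>star_alg (range F). \<phi> a = \<phi>\<^sub>S a) \<and> normal_in_rep \<pi> \<phi>)"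
    if "is_quasi_free F S \<phi>\<^sub>S" for \<phi>\<^sub>S
  proof -
    have eq: "\<phi> a = \<phi>\<^sub>S a" if "a \<in> star_alg (range F)" for a
      by (rule quasi_free_unique[OF qf \<open>is_quasi_free F S \<phi>\<^sub>S\<close> that])
    have "bounded_on (star_alg (range F)) \<phi>\<^sub>S"
      unfolding bounded_on_def
      using vector_series_bound[OF rep \<phi>(1)] eq by metis
    then show ?thesis using eq bounded vector_series_normal[OF rep \<phi>(1)] by blast
  qed
  then show ?thesis using qf by blast
qed

end
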